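(* Let $\tau:M\to M_0$ be a fibration of smooth real Banach manifolds with vertical subbundle $\mathsf V=\ker(T\tau)\subset TM$, and let $N:TM\to TM$ be an $\mathcal N$-operator on $M$ which is projectable, with projection $N_0:TM_0\to TM_0$. Put $$\hat Z_\pm=\{X+iY\in T^{\mathbb C}M\ \big|\ Y\mp NX\in \mathsf V\}.$$ Then $N_0$ is a complex structure on $M_0$ if and only if $N^2+\mathrm{id}$ takes only vertical values (i.e. values in $\mathsf V$) and the complex distribution $\hat Z_+\subset T^{\mathbb C}M$ (equivalently, the complex distribution $\hat Z_-\subset T^{\mathbb C}M$) is involutive.
   Context: All manifolds are smooth ($C^\infty$) real Banach manifolds, possibly infinite-dimensional. A vector bundle morphism between Banach vector bundles is a smooth fibre-preserving map that is bounded linear on fibres; locally, for trivial bundles $E\times F$ and $E'\times F'$, it has the form $\Phi(p,y)=(\Phi_0(p),\Phi_p(y))$ with $\Phi_0$ smooth and $\Phi_p\in B(F,F')$ a bounded linear operator. An $\mathcal N$-operator on a Banach manifold $M$ is a vector bundle morphism $N:TM\to TM$ covering the identity on $M$. If $M$ is modelled on a Banach space $E$, then locally $TM=E\times E$, vector fields are smooth maps $X:E\to E$, and $N$ is interpreted as a smooth map $E\to B(E)$, where $B(E)$ denotes the bounded linear operators on $E$. The Lie bracket of (local) vector fields is given locally by $[X,Y]_p=D_pX(Y_p)-D_pY(X_p)$ (the overall sign convention does not affect the statement). The Nijenhuis torsion of $N$ is defined on local vector fields by $$\mathcal T_N(X,Y)=[NX,NY]-N\big([NX,Y]+[X,NY]-N[X,Y]\big);$$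 it is known to be tensorial, i.e. $\mathcal T_N(X,Y)_p$ depends only on $X_p,Y_p$. All definitions are local: only local vector fields are used, and global ones need not exist. $N$ is called a Nijenhuis operator if $\mathcal T_N=0$. An $\mathcal N$-operator $N$ is an almost complex structure if $N^2=-\mathrm{id}$, and a complex structure if in addition $\mathcal T_N=0$. A fibration $\tau:M\to M_0$ is a smooth surjective submersion of Banach manifolds: each $T_m\tau:T_mM\to T_{\tau(m)}M_0$ is surjective; the kernel of $T_m\tau$ is not assumed to admit a complementary Banach subspace. An $\mathcal N$-operator $N$ on $M$ is projectable, with projection an $\mathcal N$-operator $N_0$ on $M_0$, if $N_0\circ T\tau=T\tau\circ N$ (in particular $N(\mathsf V)\subset\mathsf V$). $T^{\mathbb C}M$ is the complexified tangent bundle, with elements $X+iY$, $X,Y\in T_mM$; the Lie bracket is extended complex-bilinearly to local complex vector fields (smooth local sections of $T^{\mathbb C}M$). A distribution $Z\subset T^{\mathbb C}M$ is involutive if the bracket of any two smooth local sections with values in $Z$ again has values in $Z$. *)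

theory Defs
  imports "HOL-Analysis.Analysis" "HOL-Library.Function_Algebras"
begin

section \<open>Smooth maps between open subsets of Banach spaces\<close>

definition bounded_multilinear ::
  "nat \<Rightarrow> ('a::real_normed_vector list \<Rightarrow> 'b::real_normed_vector) \<Rightarrow> bool" where
  "bounded_multilinear n T \<longleftrightarrow>
     (\<forall>us ws. length us + 1 + length ws = n \<longrightarrow> linear (\<lambda>v. T (us @ v # ws))) \<and>
     (\<exists>K. \<forall>vs. length vs = n \<longrightarrow> norm (T vs) \<le> K * (\<Prod>v\<leftarrow>vs. norm v))"

text \<open>
  \<open>C\<^sup>\<infinity>\<close> in the Frechet sense. The iterated derivatives live in the types
  \<open>'b\<close>, \<open>'a \<Rightarrow>\<^sub>L 'b\<close>, \<open>'a \<Rightarrow>\<^sub>L 'a \<Rightarrow>\<^sub>L 'b\<close>, ..., over which one cannot recurse. So the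
  \<open>n\<close>-th derivative at \<open>x\<close> is encoded as the bounded \<open>n\<close>-linear map \<open>\<lambda>vs. D vs x\<close> on lists of
  length \<open>n\<close>, and the last conjunct says that the \<open>n\<close>-th derivative is, for the operator norm
  on bounded \<open>n\<close>-linear maps, Frechet differentiable at \<open>x\<close> with derivative
  \<open>h \<mapsto> (vs \<mapsto> D (h # vs) x)\<close>.
\<close>

definition smooth_on ::
  "('a::real_normed_vector \<Rightarrow> 'b::real_normed_vector) \<Rightarrow> 'a set \<Rightarrow> bool" where
  "smooth_on f S \<longleftrightarrow> open S \<and>
     (\<exists>D :: 'a list \<Rightarrow> 'a \<Rightarrow> 'b.
        (\<forall>x\<in>S. D [] x = f x) \<and>
        (\<forall>n. \<forall>x\<in>S. bounded_multilinear n (\<lambda>vs. D vs x)) \<and>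
        (\<forall>n. \<forall>x\<in>S. \<forall>e>0. \<forall>\<^sub>F y in nhds x. \<forall>vs. length vs = n \<longrightarrow>
           norm (D vs y - D vs x - D ((y - x) # vs) x)
             \<le> e * norm (y - x) * (\<Prod>v\<leftarrow>vs. norm v)))"


section \<open>Banach manifolds\<close>

text \<open>
  A chart is its domain together with its coordinate map, whose values off the domain are
  irrelevant. A manifold is given by an atlas; its underlying set and its topology are
  determined by the atlas. No separation or countability axiom is imposed.
\<close>

type_synonym ('m, 'e) chart = "'m set \<times> ('m \<Rightarrow> 'e)"
type_synonym ('m, 'e) atlas = "('m, 'e) chart set"

definition chart_inv :: "('m, 'e) chart \<Rightarrow> 'e \<Rightarrow> 'm" where
  "chart_inv c = inv_into (fst c) (snd c)"

definition transition :: "('m, 'e) chart \<Rightarrow> ('m, 'e) chart \<Rightarrow> 'e \<Rightarrow> 'e" where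
  "transition c d = snd d \<circ> chart_inv c"

definition carrier :: "('m, 'e) atlas \<Rightarrow> 'm set" where
  "carrier A = (\<Union>c\<in>A. fst c)"

definition charts_at :: "('m, 'e) atlas \<Rightarrow> 'm \<Rightarrow> ('m, 'e) chart set" where
  "charts_at A m = {c \<in> A. m \<in> fst c}"

locale banach_manifold =
  fixes A :: "('m, 'e::banach) atlas"
  assumes chart_inj: "c \<in> A \<Longrightarrow> inj_on (snd c) (fst c)"
    and chart_open: "c \<in> A \<Longrightarrow> open (snd c ` fst c)"
    and overlap_open: "c \<in> A \<Longrightarrow> d \<in> A \<Longrightarrow> open (snd c ` (fst c \<inter> fst d))"
    and transition_smooth:
      "c \<in> A \<Longrightarrow> d \<in> A \<Longrightarrow> smooth_on (transition c d) (snd c ` (fst c \<inter> fst d))"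

definition manifold_open :: "('m, 'e::real_normed_vector) atlas \<Rightarrow> 'm set \<Rightarrow> bool" where
  "manifold_open A W \<longleftrightarrow> W \<subseteq> carrier A \<and> (\<forall>c\<in>A. open (snd c ` (fst c \<inter> W)))"

text \<open>
  The neighbourhood \<open>W'\<close> is needed because the atlas need not be maximal. The condition
  \<open>f ` W' \<subseteq> fst d\<close> makes continuity of \<open>f\<close> part of the definition.
\<close>

definition smooth_map_on ::
  "('m, 'e::real_normed_vector) atlas \<Rightarrow> ('k, 'f::real_normed_vector) atlas \<Rightarrow>
     'm set \<Rightarrow> ('m \<Rightarrow> 'k) \<Rightarrow> bool" where
  "smooth_map_on A B W f \<longleftrightarrow>
     (\<forall>m\<in>W. \<exists>c\<in>A. \<exists>d\<in>B. \<exists>W'. manifold_open A W' \<and> m \<in> W' \<and> W' \<subseteq> fst c \<inter> W \<and>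
        f ` W' \<subseteq> fst d \<and> smooth_on (snd d \<circ> f \<circ> chart_inv c) (snd c ` W'))"


section \<open>Tangent bundle\<close>

text \<open>
  A tangent vector at \<open>m\<close> is an equivalence class of pairs \<open>(c, v)\<close> of a chart at \<open>m\<close> and a
  vector of the model space, where \<open>(c, v)\<close> and \<open>(d, w)\<close> are identified if
  \<open>w = D (d \<circ> c\<^sup>-\<^sup>1) v\<close>. Such a class contains exactly one pair for each chart at \<open>m\<close>, so it is
  the graph of a function on charts; that function (extended by 0) is taken as the tangent
  vector, and the vector space structure is the pointwise one.
\<close>

type_synonym ('m, 'e) tvec = "('m, 'e) chart \<Rightarrow> 'e"

definition tangent_space ::
  "('m, 'e::real_normed_vector) atlas \<Rightarrow> 'm \<Rightarrow> ('m, 'e) tvec set" where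
  "tangent_space A m =
     {v. (\<forall>c\<in>charts_at A m. \<forall>d\<in>charts_at A m.
            v d = frechet_derivative (transition c d) (at (snd c m)) (v c)) \<and>
         (\<forall>c. c \<notin> charts_at A m \<longrightarrow> v c = 0)}"

definition tangent_chart ::
  "('m, 'e::real_normed_vector) atlas \<Rightarrow> ('m, 'e) chart \<Rightarrow>
     ('m \<times> ('m, 'e) tvec, 'e \<times> 'e) chart" where
  "tangent_chart A c = ((SIGMA m:fst c. tangent_space A m), (\<lambda>(m, v). (snd c m, v c)))"

definition tangent_bundle ::
  "('m, 'e::real_normed_vector) atlas \<Rightarrow> ('m \<times> ('m, 'e) tvec, 'e \<times> 'e) atlas" where
  "tangent_bundle A = tangent_chart A ` A"

text \<open>
  The tangent map of a smooth map does not depend on the chart \<open>c\<close> chosen at \<open>m\<close>.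
\<close>

definition tangent_map ::
  "('m, 'e::real_normed_vector) atlas \<Rightarrow> ('k, 'f::real_normed_vector) atlas \<Rightarrow> ('m \<Rightarrow> 'k) \<Rightarrow>
     'm \<Rightarrow> ('m, 'e) tvec \<Rightarrow> ('k, 'f) tvec" where
  "tangent_map A B f m v =
     (let c = (SOME c. c \<in> charts_at A m) in
       (\<lambda>d. if d \<in> charts_at B (f m)
            then frechet_derivative (snd d \<circ> f \<circ> chart_inv c) (at (snd c m)) (v c)
            else 0))"


section \<open>Local vector fields and Lie bracket\<close>

definition vector_field_on ::
  "('m, 'e::real_normed_vector) atlas \<Rightarrow> 'm set \<Rightarrow> ('m \<Rightarrow> ('m, 'e) tvec) \<Rightarrow> bool" where
  "vector_field_on A W X \<longleftrightarrow>
     (\<forall>m\<in>W. X m \<in> tangent_space A m) \<and>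
     smooth_map_on A (tangent_bundle A) W (\<lambda>m. (m, X m))"

definition local_rep ::
  "('m \<Rightarrow> ('m, 'e) tvec) \<Rightarrow> ('m, 'e) chart \<Rightarrow> 'e \<Rightarrow> 'e" where
  "local_rep X c = (\<lambda>p. X (chart_inv c p) c)"

definition lie_bracket ::
  "('m, 'e::real_normed_vector) atlas \<Rightarrow> ('m \<Rightarrow> ('m, 'e) tvec) \<Rightarrow>
     ('m \<Rightarrow> ('m, 'e) tvec) \<Rightarrow> 'm \<Rightarrow> ('m, 'e) tvec" where
  "lie_bracket A X Y m =
     (\<lambda>c. if c \<in> charts_at A m
          then frechet_derivative (local_rep X c) (at (snd c m)) (Y m c)
             - frechet_derivative (local_rep Y c) (at (snd c m)) (X m c)
          else 0)"


section \<open>\<open>\<N>\<close>-operators\<close>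

text \<open>
  \<open>N m\<close> is the restriction of the bundle morphism to the fibre at \<open>m\<close>, so \<open>N\<close> covers the identity
  by construction. Smoothness is that of the map of total spaces.
\<close>

definition N_operator ::
  "('m, 'e::real_normed_vector) atlas \<Rightarrow> ('m \<Rightarrow> ('m, 'e) tvec \<Rightarrow> ('m, 'e) tvec) \<Rightarrow> bool" where
  "N_operator A N \<longleftrightarrow>
     (\<forall>m\<in>carrier A. \<forall>v\<in>tangent_space A m. N m v \<in> tangent_space A m) \<and>
     (\<forall>m\<in>carrier A. \<forall>c\<in>charts_at A m.
        \<exists>L. bounded_linear L \<and> (\<forall>v\<in>tangent_space A m. N m v c = L (v c))) \<and>
     smooth_map_on (tangent_bundle A) (tangent_bundle A) (carrier (tangent_bundle A))
       (\<lambda>(m, v). (m, N m v))"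

definition torsion ::
  "('m, 'e::real_normed_vector) atlas \<Rightarrow> ('m \<Rightarrow> ('m, 'e) tvec \<Rightarrow> ('m, 'e) tvec) \<Rightarrow>
     ('m \<Rightarrow> ('m, 'e) tvec) \<Rightarrow> ('m \<Rightarrow> ('m, 'e) tvec) \<Rightarrow> 'm \<Rightarrow> ('m, 'e) tvec" where
  "torsion A N X Y m =
     (let NX = (\<lambda>q. N q (X q)); NY = (\<lambda>q. N q (Y q)) in
       lie_bracket A NX NY m
       - N m (lie_bracket A NX Y m + lie_bracket A X NY m - N m (lie_bracket A X Y m)))"

definition nijenhuis_operator ::
  "('m, 'e::real_normed_vector) atlas \<Rightarrow> ('m \<Rightarrow> ('m, 'e) tvec \<Rightarrow> ('m, 'e) tvec) \<Rightarrow> bool" where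
  "nijenhuis_operator A N \<longleftrightarrow> N_operator A N \<and>
     (\<forall>W X Y. manifold_open A W \<longrightarrow> vector_field_on A W X \<longrightarrow> vector_field_on A W Y \<longrightarrow>
        (\<forall>m\<in>W. torsion A N X Y m = 0))"

definition almost_complex_structure ::
  "('m, 'e::real_normed_vector) atlas \<Rightarrow> ('m \<Rightarrow> ('m, 'e) tvec \<Rightarrow> ('m, 'e) tvec) \<Rightarrow> bool" where
  "almost_complex_structure A N \<longleftrightarrow> N_operator A N \<and>
     (\<forall>m\<in>carrier A. \<forall>v\<in>tangent_space A m. N m (N m v) = - v)"

definition complex_structure ::
  "('m, 'e::real_normed_vector) atlas \<Rightarrow> ('m \<Rightarrow> ('m, 'e) tvec \<Rightarrow> ('m, 'e) tvec) \<Rightarrow> bool" where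
  "complex_structure A N \<longleftrightarrow> almost_complex_structure A N \<and> nijenhuis_operator A N"


section \<open>Fibrations\<close>

definition fibration ::
  "('m, 'e::real_normed_vector) atlas \<Rightarrow> ('k, 'f::real_normed_vector) atlas \<Rightarrow> ('m \<Rightarrow> 'k) \<Rightarrow> bool" where
  "fibration A A\<^sub>0 \<tau> \<longleftrightarrow>
     smooth_map_on A A\<^sub>0 (carrier A) \<tau> \<and> \<tau> ` carrier A = carrier A\<^sub>0 \<and>
     (\<forall>m\<in>carrier A. tangent_map A A\<^sub>0 \<tau> m ` tangent_space A m = tangent_space A\<^sub>0 (\<tau> m))"

definition vertical ::
  "('m, 'e::real_normed_vector) atlas \<Rightarrow> ('k, 'f::real_normed_vector) atlas \<Rightarrow> ('m \<Rightarrow> 'k) \<Rightarrow>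
     'm \<Rightarrow> ('m, 'e) tvec set" where
  "vertical A A\<^sub>0 \<tau> m = {v \<in> tangent_space A m. tangent_map A A\<^sub>0 \<tau> m v = 0}"

definition projects_to ::
  "('m, 'e::real_normed_vector) atlas \<Rightarrow> ('k, 'f::real_normed_vector) atlas \<Rightarrow> ('m \<Rightarrow> 'k) \<Rightarrow>
     ('m \<Rightarrow> ('m, 'e) tvec \<Rightarrow> ('m, 'e) tvec) \<Rightarrow>
     ('k \<Rightarrow> ('k, 'f) tvec \<Rightarrow> ('k, 'f) tvec) \<Rightarrow> bool" where
  "projects_to A A\<^sub>0 \<tau> N N\<^sub>0 \<longleftrightarrow>
     (\<forall>m\<in>carrier A. \<forall>v\<in>tangent_space A m.
        N\<^sub>0 (\<tau> m) (tangent_map A A\<^sub>0 \<tau> m v) = tangent_map A A\<^sub>0 \<tau> m (N m v))"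


section \<open>Complexified tangent bundle\<close>

text \<open>
  The complex tangent vector \<open>X + iY\<close> is the pair \<open>(X, Y)\<close>. The bracket of complex vector fields is
  the complex bilinear extension
  \<open>[X + iY, X' + iY'] = ([X, X'] - [Y, Y']) + i([X, Y'] + [Y, X'])\<close>.
\<close>

type_synonym ('m, 'e) ctvec = "('m, 'e) tvec \<times> ('m, 'e) tvec"

definition complex_vector_field_on ::
  "('m, 'e::real_normed_vector) atlas \<Rightarrow> 'm set \<Rightarrow> ('m \<Rightarrow> ('m, 'e) ctvec) \<Rightarrow> bool" where
  "complex_vector_field_on A W P \<longleftrightarrow>
     vector_field_on A W (\<lambda>m. fst (P m)) \<and> vector_field_on A W (\<lambda>m. snd (P m))"

definition complex_lie_bracket ::
  "('m, 'e::real_normed_vector) atlas \<Rightarrow> ('m \<Rightarrow> ('m, 'e) ctvec) \<Rightarrow>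
     ('m \<Rightarrow> ('m, 'e) ctvec) \<Rightarrow> 'm \<Rightarrow> ('m, 'e) ctvec" where
  "complex_lie_bracket A P Q m =
     (let X = (\<lambda>q. fst (P q)); Y = (\<lambda>q. snd (P q));
          X' = (\<lambda>q. fst (Q q)); Y' = (\<lambda>q. snd (Q q))
      in (lie_bracket A X X' m - lie_bracket A Y Y' m,
          lie_bracket A X Y' m + lie_bracket A Y X' m))"

definition involutive ::
  "('m, 'e::real_normed_vector) atlas \<Rightarrow> ('m \<Rightarrow> ('m, 'e) ctvec set) \<Rightarrow> bool" where
  "involutive A Z \<longleftrightarrow>
     (\<forall>W P Q. manifold_open A W \<longrightarrow>
        complex_vector_field_on A W P \<longrightarrow> complex_vector_field_on A W Q \<longrightarrow>
        (\<forall>m\<in>W. P m \<in> Z m) \<longrightarrow> (\<forall>m\<in>W. Q m \<in> Z m) \<longrightarrow>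
        (\<forall>m\<in>W. complex_lie_bracket A P Q m \<in> Z m))"

definition Zhat_plus ::
  "('m, 'e::real_normed_vector) atlas \<Rightarrow> ('k, 'f::real_normed_vector) atlas \<Rightarrow> ('m \<Rightarrow> 'k) \<Rightarrow>
     ('m \<Rightarrow> ('m, 'e) tvec \<Rightarrow> ('m, 'e) tvec) \<Rightarrow> 'm \<Rightarrow> ('m, 'e) ctvec set" where
  "Zhat_plus A A\<^sub>0 \<tau> N m =
     {(X, Y). X \<in> tangent_space A m \<and> Y \<in> tangent_space A m \<and> Y - N m X \<in> vertical A A\<^sub>0 \<tau> m}"

definition Zhat_minus ::
  "('m, 'e::real_normed_vector) atlas \<Rightarrow> ('k, 'f::real_normed_vector) atlas \<Rightarrow> ('m \<Rightarrow> 'k) \<Rightarrow>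
     ('m \<Rightarrow> ('m, 'e) tvec \<Rightarrow> ('m, 'e) tvec) \<Rightarrow> 'm \<Rightarrow> ('m, 'e) ctvec set" where
  "Zhat_minus A A\<^sub>0 \<tau> N m =
     {(X, Y). X \<in> tangent_space A m \<and> Y \<in> tangent_space A m \<and> Y + N m X \<in> vertical A A\<^sub>0 \<tau> m}"

end

theory Submission
  imports Defs
begin

text \<open>
  Write \<open>T\<close> for the tangent map of \<open>\<tau>\<close>, and \<open>x = T X\<close>, \<open>y = T Y\<close> for the vector fields along \<open>\<tau>\<close>
  obtained from vector fields \<open>X\<close>, \<open>Y\<close> on \<open>M\<close>. In charts
    \<open>T [X, Y] = Dx (Y) - Dy (X)\<close>,
  because the two terms with the second derivative of \<open>\<tau>\<close> cancel by symmetry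
  (\<open>smooth_on_bracket\<close>). Hence brackets can be pushed down to \<open>M\<^sub>0\<close> even if \<open>X\<close> and \<open>Y\<close> are
  not projectable, as happens for general sections of the distribution.

  A section \<open>X + iY\<close> of \<open>Z\<^sub>+\<close> is one with \<open>T Y = N\<^sub>0 (T X)\<close>. Take two sections with
  real parts mapped by \<open>T\<close> to \<open>x\<close> and \<open>x'\<close>, and let \<open>R + iI\<close> be their bracket. The bracket has values in
  \<open>Z\<^sub>+\<close> exactly if \<open>T (I - N R) = 0\<close>. Expanding by the product rule, all derivatives of \<open>x\<close> and
  \<open>x'\<close> drop out as soon as \<open>N\<^sub>0\<^sup>2 = -id\<close>, and what remains is
    \<open>T (I - N R) = N\<^sub>0 (\<T>(x, x'))\<close>, with \<open>\<T>\<close> the torsion of \<open>N\<^sub>0\<close>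
  (\<open>complex_bracket_defect\<close>), where the torsion is written as a tensor in a chart (\<open>torsion_form\<close>,
  \<open>torsion_chart\<close>).

  So vanishing torsion makes \<open>Z\<^sub>+\<close> involutive. Conversely \<open>T\<close> is onto, so any two tangent vectors of
  \<open>M\<^sub>0\<close> are values of \<open>x\<close> and \<open>x'\<close> for sections of the form \<open>X + i NX\<close>
  (\<open>ex_vector_field_with_smooth_image\<close>), and \<open>N\<^sub>0\<close> is injective, so involutivity kills the torsion.
  Surjectivity of \<open>T\<close> also shows that \<open>N\<^sup>2 + id\<close> is vertical iff \<open>N\<^sub>0\<^sup>2 = -id\<close> (\<open>square_vertical_iff\<close>).
  Finally \<open>Z\<^sub>-\<close> is the complex conjugate of \<open>Z\<^sub>+\<close>, and conjugation commutes with the bracket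
  (\<open>involutive_conjugate\<close>).

  The argument differentiates given smooth maps at most twice, and the only smooth maps it
  has to construct are negatives of vector fields, vector fields constant in a chart and the
  images of the latter under \<open>N\<close>. Therefore \<open>smooth_on\<close> is needed only under affine
  substitutions and bounded linear maps, and every other chain rule is that of Frechet derivatives.
\<close>

section \<open>Smooth maps: closure properties and second derivatives\<close>

lemma prod_list_norm_nonneg: "0 \<le> (\<Prod>v\<leftarrow>vs. norm v)"
  by (induction vs) auto

text \<open>
  The witness \<open>D\<close> in the definition of \<open>smooth_on\<close>, made explicit so that the derivatives of a new map
  can be written down in terms of those of a given one.
\<close>
definition derivatives_on ::
  "('a::real_normed_vector list \<Rightarrow> 'a \<Rightarrow> 'b::real_normed_vector) \<Rightarrow> ('a \<Rightarrow> 'b) \<Rightarrow> 'a set \<Rightarrow> bool" where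
  "derivatives_on D f S \<longleftrightarrow>
     (\<forall>x\<in>S. D [] x = f x) \<and>
     (\<forall>n. \<forall>x\<in>S. bounded_multilinear n (\<lambda>vs. D vs x)) \<and>
     (\<forall>n. \<forall>x\<in>S. \<forall>e>0. \<forall>\<^sub>F y in nhds x. \<forall>vs. length vs = n \<longrightarrow>
        norm (D vs y - D vs x - D ((y - x) # vs) x)
          \<le> e * norm (y - x) * (\<Prod>v\<leftarrow>vs. norm v))"

lemma smooth_on_iff: "smooth_on f S \<longleftrightarrow> open S \<and> (\<exists>D. derivatives_on D f S)"
  unfolding smooth_on_def derivatives_on_def ..

lemma smooth_onE:
  assumes "smooth_on f S"
  obtains D where "open S" "derivatives_on D f S"
  using assms smooth_on_iff by blast

lemma derivatives_onI:
  assumes "\<And>x. x \<in> S \<Longrightarrow> D [] x = f x"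
    and "\<And>n x. x \<in> S \<Longrightarrow> bounded_multilinear n (\<lambda>vs. D vs x)"
    and "\<And>n x e. x \<in> S \<Longrightarrow> e > 0 \<Longrightarrow> \<forall>\<^sub>F y in nhds x. \<forall>vs. length vs = n \<longrightarrow>
        norm (D vs y - D vs x - D ((y - x) # vs) x) \<le> e * norm (y - x) * (\<Prod>v\<leftarrow>vs. norm v)"
  shows "derivatives_on D f S"
  unfolding derivatives_on_def
proof (intro conjI ballI allI impI)
  show "D [] x = f x" if "x \<in> S" for x using assms(1)[OF that] .
  show "bounded_multilinear n (\<lambda>vs. D vs x)" if "x \<in> S" for n x using assms(2)[OF that] .
  show "\<forall>\<^sub>F y in nhds x. \<forall>vs. length vs = n \<longrightarrow>
        norm (D vs y - D vs x - D ((y - x) # vs) x) \<le> e * norm (y - x) * (\<Prod>v\<leftarrow>vs. norm v)"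
    if "x \<in> S" "e > 0" for n x e using assms(3)[OF that] .
qed

lemma derivatives_onD:
  assumes "derivatives_on D f S" "x \<in> S"
  shows "D [] x = f x"
    and "bounded_multilinear n (\<lambda>vs. D vs x)"
    and "e > 0 \<Longrightarrow> \<forall>\<^sub>F y in nhds x. \<forall>vs. length vs = n \<longrightarrow>
        norm (D vs y - D vs x - D ((y - x) # vs) x) \<le> e * norm (y - x) * (\<Prod>v\<leftarrow>vs. norm v)"
proof -
  note d = assms(1)[unfolded derivatives_on_def]
  show "D [] x = f x" using conjunct1[OF d] assms(2) by (rule bspec)
  show "bounded_multilinear n (\<lambda>vs. D vs x)"
    using conjunct1[OF conjunct2[OF d], THEN spec, of n] assms(2) by (rule bspec)
  show "\<forall>\<^sub>F y in nhds x. \<forall>vs. length vs = n \<longrightarrow>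
        norm (D vs y - D vs x - D ((y - x) # vs) x) \<le> e * norm (y - x) * (\<Prod>v\<leftarrow>vs. norm v)" if "e > 0"
    using conjunct2[OF conjunct2[OF d], THEN spec, of n] assms(2) that by blast
qed

lemma bounded_multilinearE:
  assumes "bounded_multilinear n T"
  obtains K where "K > 0" "\<And>vs. length vs = n \<Longrightarrow> norm (T vs) \<le> K * (\<Prod>v\<leftarrow>vs. norm v)"
    "\<And>us ws. length us + 1 + length ws = n \<Longrightarrow> linear (\<lambda>v. T (us @ v # ws))"
proof -
  obtain K where K: "\<And>vs. length vs = n \<Longrightarrow> norm (T vs) \<le> K * (\<Prod>v\<leftarrow>vs. norm v)"
    using conjunct2[OF assms[unfolded bounded_multilinear_def]] by blast
  have "norm (T vs) \<le> (\<bar>K\<bar> + 1) * (\<Prod>v\<leftarrow>vs. norm v)" if "length vs = n" for vs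
    by (rule order_trans[OF K[OF that] mult_right_mono]) (auto simp: prod_list_norm_nonneg)
  moreover have "linear (\<lambda>v. T (us @ v # ws))" if "length us + 1 + length ws = n" for us ws
    using conjunct1[OF assms[unfolded bounded_multilinear_def]] that by blast
  moreover have "\<bar>K\<bar> + 1 > 0" by simp
  ultimately show ?thesis using that by blast
qed

lemma bounded_multilinearI:
  assumes "\<And>us ws. length us + 1 + length ws = n \<Longrightarrow> linear (\<lambda>v. T (us @ v # ws))"
    and "\<And>vs. length vs = n \<Longrightarrow> norm (T vs) \<le> K * (\<Prod>v\<leftarrow>vs. norm v)"
  shows "bounded_multilinear n T"
  unfolding bounded_multilinear_def using assms by blast

lemma smooth_on_imp_open: "smooth_on f S \<Longrightarrow> open S"
  by (simp add: smooth_on_def)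

lemma smooth_on_subset:
  assumes "smooth_on f S" "T \<subseteq> S" "open T"
  shows "smooth_on f T"
proof -
  obtain D where D: "derivatives_on D f S" using assms(1) by (rule smooth_onE)
  have "derivatives_on D f T"
    using assms(2) by (intro derivatives_onI derivatives_onD[OF D]) auto
  then show ?thesis using assms(3) smooth_on_iff by blast
qed

lemma smooth_on_cong:
  assumes "smooth_on f S" "\<And>x. x \<in> S \<Longrightarrow> f x = g x"
  shows "smooth_on g S"
proof -
  obtain D where D: "open S" "derivatives_on D f S" using assms(1) by (rule smooth_onE)
  have "derivatives_on D g S"
    by (rule derivatives_onI) (simp_all add: derivatives_onD[OF D(2)] assms(2)[symmetric])
  then show ?thesis using D(1) smooth_on_iff by blast
qed

lemma smooth_on_affine:
  assumes L: "bounded_linear L" and S: "open S"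
  shows "smooth_on (\<lambda>x. L x + b) S"
proof -
  interpret L: bounded_linear L by (rule L)
  define D where "D vs x = (case vs of [] \<Rightarrow> L x + b | [h] \<Rightarrow> L h | _ \<Rightarrow> 0)" for vs x
  have lin1: "linear L" by (rule L.linear)
  obtain K where K: "\<And>h. norm (L h) \<le> norm h * K" using L.bounded by blast
  have bm: "bounded_multilinear n (\<lambda>vs. D vs x)" for n x
  proof -
    have "linear (\<lambda>v. D (us @ v # ws) x)" for us ws
    proof -
      consider "us = []" "ws = []" | w ws' where "us = []" "ws = w # ws'" | u where "us = [u]" | u u' us' where "us = u # u' # us'"
        by (metis list.exhaust)
      then show ?thesis by cases (auto simp: D_def lin1 linear_zero)
    qed
    moreover have "\<exists>M. \<forall>vs. length vs = n \<longrightarrow> norm (D vs x) \<le> M * (\<Prod>v\<leftarrow>vs. norm v)"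
    proof (cases n)
      case 0 then show ?thesis by (auto simp: D_def)
    next
      case (Suc k)
      have "norm (D vs x) \<le> \<bar>K\<bar> * (\<Prod>v\<leftarrow>vs. norm v)" if "length vs = n" for vs
      proof (cases "\<exists>h. vs = [h]")
        case True
        then obtain h where h: "vs = [h]" by blast
        have "norm h * K \<le> norm h * \<bar>K\<bar>" by (rule mult_left_mono) auto
        then show ?thesis using K[of h] by (simp add: h D_def mult.commute)
      next
        case False
        then have "D vs x = 0" using that Suc by (auto simp: D_def split: list.split)
        then show ?thesis by (simp add: prod_list_norm_nonneg)
      qed
      then show ?thesis by blast
    qed
    ultimately show ?thesis by (simp add: bounded_multilinear_def)
  qed
  have "D vs y - D vs x - D ((y - x) # vs) x = 0" for vs x y
    by (auto simp: D_def L.diff split: list.split)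
  then have "\<forall>\<^sub>F y in nhds x. \<forall>vs. length vs = n \<longrightarrow>
           norm (D vs y - D vs x - D ((y - x) # vs) x) \<le> e * norm (y - x) * (\<Prod>v\<leftarrow>vs. norm v)"
    if "e > 0" for x n e
    using that by (auto intro!: always_eventually mult_nonneg_nonneg prod_list_norm_nonneg)
  moreover have "D [] x = L x + b" for x by (simp add: D_def)
  ultimately have "derivatives_on D (\<lambda>x. L x + b) S" using bm by (intro derivatives_onI)
  then show ?thesis using S smooth_on_iff by blast
qed

lemma smooth_on_bounded_linear_compose:
  fixes f :: "'a::real_normed_vector \<Rightarrow> 'b::real_normed_vector" and L :: "'b \<Rightarrow> 'c::real_normed_vector"
  assumes L: "bounded_linear L" and f: "smooth_on f S"
  shows "smooth_on (\<lambda>x. L (f x)) S"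
proof -
  interpret L: bounded_linear L by (rule L)
  obtain K where K: "K > 0" "\<And>h. norm (L h) \<le> norm h * K" using L.pos_bounded by blast
  obtain D where D0: "open S" "derivatives_on D f S" using f by (rule smooth_onE)
  note D = derivatives_onD[OF D0(2)]
  have bm: "bounded_multilinear n (\<lambda>vs. L (D vs x))" if x: "x \<in> S" for n x
  proof -
    obtain M where "M > 0" and M: "\<And>vs. length vs = n \<Longrightarrow> norm (D vs x) \<le> M * (\<Prod>v\<leftarrow>vs. norm v)"
      and lin: "\<And>us ws. length us + 1 + length ws = n \<Longrightarrow> linear (\<lambda>v. D (us @ v # ws) x)"
      using D(2)[OF x, of n] by (rule bounded_multilinearE) (rule that)
    have "linear (\<lambda>v. L (D (us @ v # ws) x))" if "length us + 1 + length ws = n" for us ws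
      using linear_compose[OF lin[OF that] L.linear] by (simp add: o_def)
    moreover have "norm (L (D vs x)) \<le> (K * M) * (\<Prod>v\<leftarrow>vs. norm v)" if "length vs = n" for vs
    proof -
      have "norm (L (D vs x)) \<le> norm (D vs x) * K" by (rule K(2))
      also have "\<dots> \<le> (M * (\<Prod>v\<leftarrow>vs. norm v)) * K"
        using M[OF that] K(1) by (intro mult_right_mono) auto
      finally show ?thesis by (simp add: mult_ac)
    qed
    ultimately show ?thesis by (rule bounded_multilinearI)
  qed
  have "\<forall>\<^sub>F y in nhds x. \<forall>vs. length vs = n \<longrightarrow>
           norm (L (D vs y) - L (D vs x) - L (D ((y - x) # vs) x)) \<le> e * norm (y - x) * (\<Prod>v\<leftarrow>vs. norm v)"
    if "x \<in> S" "e > 0" for x n e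
  proof -
    have "e / K > 0" using that K by simp
    from D(3)[OF that(1) this, of n] show ?thesis
    proof (rule eventually_mono, intro allI impI)
      fix y and vs :: "'a list" assume "\<forall>vs. length vs = n \<longrightarrow>
           norm (D vs y - D vs x - D ((y - x) # vs) x) \<le> e/K * norm (y - x) * (\<Prod>v\<leftarrow>vs. norm v)"
         and "length vs = n"
      then have *: "norm (D vs y - D vs x - D ((y - x) # vs) x) \<le> e/K * norm (y - x) * (\<Prod>v\<leftarrow>vs. norm v)"
        by blast
      have "norm (L (D vs y) - L (D vs x) - L (D ((y - x) # vs) x))
          \<le> norm (D vs y - D vs x - D ((y - x) # vs) x) * K"
        using K(2)[of "D vs y - D vs x - D ((y - x) # vs) x"] by (simp add: L.diff)
      also have "\<dots> \<le> (e/K * norm (y - x) * (\<Prod>v\<leftarrow>vs. norm v)) * K"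
        using * K(1) by (intro mult_right_mono) auto
      also have "\<dots> = e * norm (y - x) * (\<Prod>v\<leftarrow>vs. norm v)" using K(1) by simp
      finally show "norm (L (D vs y) - L (D vs x) - L (D ((y - x) # vs) x)) \<le> e * norm (y - x) * (\<Prod>v\<leftarrow>vs. norm v)" .
    qed
  qed
  then have "derivatives_on (\<lambda>vs x. L (D vs x)) (\<lambda>x. L (f x)) S"
    using bm by (intro derivatives_onI) (simp_all add: D(1))
  then show ?thesis using D0(1) smooth_on_iff by blast
qed

lemma smooth_on_compose_affine:
  fixes f :: "'b::real_normed_vector \<Rightarrow> 'c::real_normed_vector" and L :: "'a::real_normed_vector \<Rightarrow> 'b"
  assumes L: "bounded_linear L" and f: "smooth_on f S" and T: "open T"
    and TS: "\<And>x. x \<in> T \<Longrightarrow> L x + b \<in> S"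
  shows "smooth_on (\<lambda>x. f (L x + b)) T"
proof -
  interpret L: bounded_linear L by (rule L)
  obtain K where K: "K > 0" "\<And>h. norm (L h) \<le> norm h * K" using L.pos_bounded by blast
  obtain D where D0: "open S" "derivatives_on D f S" using f by (rule smooth_onE)
  note D = derivatives_onD[OF D0(2)]
  define D' where "D' vs x = D (map L vs) (L x + b)" for vs x
  have pr: "(\<Prod>v\<leftarrow>map L vs. norm v) \<le> K ^ length vs * (\<Prod>v\<leftarrow>vs. norm v)" for vs
  proof (induction vs)
    case (Cons v vs)
    have "norm (L v) * (\<Prod>v\<leftarrow>map L vs. norm v) \<le> (norm v * K) * (K ^ length vs * (\<Prod>v\<leftarrow>vs. norm v))"
      using K(1) by (intro mult_mono K(2) Cons.IH prod_list_norm_nonneg) auto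
    then show ?case by (simp add: mult_ac)
  qed simp
  have bm: "bounded_multilinear n (\<lambda>vs. D' vs x)" if "x \<in> T" for n x
  proof -
    have x: "L x + b \<in> S" by (rule TS[OF that])
    obtain M where "M > 0" and M: "\<And>vs. length vs = n \<Longrightarrow> norm (D vs (L x + b)) \<le> M * (\<Prod>v\<leftarrow>vs. norm v)"
      and lin: "\<And>us ws. length us + 1 + length ws = n \<Longrightarrow> linear (\<lambda>v. D (us @ v # ws) (L x + b))"
      using D(2)[OF x, of n] by (rule bounded_multilinearE) (rule that)
    have "linear (\<lambda>v. D' (us @ v # ws) x)" if "length us + 1 + length ws = n" for us ws
    proof -
      have "linear (\<lambda>v. D (map L us @ v # map L ws) (L x + b))"
        by (rule lin) (use that in simp)
      from linear_compose[OF L.linear this] show ?thesis by (simp add: o_def D'_def)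
    qed
    moreover
    have "norm (D' vs x) \<le> (M * K ^ n) * (\<Prod>v\<leftarrow>vs. norm v)" if "length vs = n" for vs
    proof -
      have "norm (D' vs x) \<le> M * (\<Prod>v\<leftarrow>map L vs. norm v)"
        unfolding D'_def using that by (intro M) auto
      also have "\<dots> \<le> M * (K ^ length vs * (\<Prod>v\<leftarrow>vs. norm v))"
        using \<open>M > 0\<close> by (intro mult_left_mono pr) auto
      finally show ?thesis using that by (simp add: mult_ac)
    qed
    ultimately show ?thesis by (rule bounded_multilinearI)
  qed
  have "\<forall>\<^sub>F y in nhds x. \<forall>vs. length vs = n \<longrightarrow>
           norm (D' vs y - D' vs x - D' ((y - x) # vs) x) \<le> e * norm (y - x) * (\<Prod>v\<leftarrow>vs. norm v)"
    if "x \<in> T" "e > 0" for x n e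
  proof -
    have e: "e / (K * K ^ n) > 0" using that K by simp
    have tendsto: "filterlim (\<lambda>y. L y + b) (nhds (L x + b)) (nhds x)"
      by (intro tendsto_add tendsto_const L.tendsto filterlim_ident)
    from eventually_compose_filterlim[OF D(3)[OF TS[OF that(1)] e, of n] tendsto] show ?thesis
    proof (rule eventually_mono, intro allI impI)
      fix y and vs :: "'a list"
      assume *: "\<forall>vs. length vs = n \<longrightarrow>
           norm (D vs (L y + b) - D vs (L x + b) - D ((L y + b - (L x + b)) # vs) (L x + b))
             \<le> e / (K * K ^ n) * norm (L y + b - (L x + b)) * (\<Prod>v\<leftarrow>vs. norm v)"
         and "length vs = n"
      then have "norm (D' vs y - D' vs x - D' ((y - x) # vs) x)
          \<le> e / (K * K ^ n) * norm (L (y - x)) * (\<Prod>v\<leftarrow>map L vs. norm v)"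
        unfolding D'_def using *[rule_format, of "map L vs"] by (simp add: L.diff)
      also have "\<dots> \<le> e / (K * K ^ n) * (norm (y - x) * K) * (K ^ n * (\<Prod>v\<leftarrow>vs. norm v))"
        using pr[of vs] \<open>length vs = n\<close> K that
        by (intro mult_mono K(2) prod_list_norm_nonneg mult_nonneg_nonneg) auto
      also have "\<dots> = e * norm (y - x) * (\<Prod>v\<leftarrow>vs. norm v)" using K(1) by simp
      finally show "norm (D' vs y - D' vs x - D' ((y - x) # vs) x) \<le> e * norm (y - x) * (\<Prod>v\<leftarrow>vs. norm v)" .
    qed
  qed
  moreover have "D' [] x = f (L x + b)" if "x \<in> T" for x using D(1)[OF TS[OF that]] by (simp add: D'_def)
  ultimately have "derivatives_on D' (\<lambda>x. f (L x + b)) T" using bm by (intro derivatives_onI)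
  then show ?thesis using T smooth_on_iff by blast
qed

lemma derivatives_on_has_derivative:
  assumes D: "derivatives_on D f S" and S: "open S" "x \<in> S"
  shows "(f has_derivative (\<lambda>h. D [h] x)) (at x)"
  unfolding has_derivative_at_alt
proof (intro conjI allI impI)
  note D' = derivatives_onD[OF D]
  obtain K where K: "K > 0" "\<And>vs. length vs = 1 \<Longrightarrow> norm (D vs x) \<le> K * (\<Prod>v\<leftarrow>vs. norm v)"
    and lin: "\<And>us ws. length us + 1 + length ws = 1 \<Longrightarrow> linear (\<lambda>v. D (us @ v # ws) x)"
    using D'(2)[OF S(2), of 1] by (rule bounded_multilinearE) (rule that)
  have "linear (\<lambda>h. D [h] x)" using lin[of "[]" "[]"] by simp
  moreover have "norm (D [h] x) \<le> norm h * K" for h using K(2)[of "[h]"] by (simp add: mult.commute)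
  ultimately show "bounded_linear (\<lambda>h. D [h] x)"
    by (intro bounded_linear.intro bounded_linear_axioms.intro) blast+
  fix e :: real assume "e > 0"
  from D'(3)[OF S(2) this, of 0] eventually_nhds_in_open[OF S]
  have "\<forall>\<^sub>F y in nhds x. norm (f y - f x - D [y - x] x) \<le> e * norm (y - x)"
    by eventually_elim (use D'(1) S(2) in auto)
  then show "\<exists>d>0. \<forall>y. norm (y - x) < d \<longrightarrow> norm (f y - f x - D [y - x] x) \<le> e * norm (y - x)"
    unfolding eventually_nhds_metric by (simp add: dist_norm)
qed

lemma derivatives_on_approx_first:
  assumes D: "derivatives_on D f S" and x: "x \<in> S" and e: "e > 0"
  obtains r where "r > 0"
    "\<And>y w. norm (y - x) < r \<Longrightarrow>
       norm (D [w] y - D [w] x - D [y - x, w] x) \<le> e * norm (y - x) * norm w"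
proof -
  from derivatives_onD(3)[OF D x e, of 1] obtain r where r: "r > 0"
    "\<And>y vs. dist y x < r \<Longrightarrow> length vs = 1 \<Longrightarrow>
       norm (D vs y - D vs x - D ((y - x) # vs) x) \<le> e * norm (y - x) * (\<Prod>v\<leftarrow>vs. norm v)"
    unfolding eventually_nhds_metric by blast
  have "norm (D [w] y - D [w] x - D [y - x, w] x) \<le> e * norm (y - x) * norm w"
    if "norm (y - x) < r" for y w
    using r(2)[of y "[w]"] that by (simp add: dist_norm)
  with r(1) show ?thesis by (rule that)
qed

text \<open>
  Joint differentiability of \<open>(y, w) \<mapsto> Df\<^sub>y w\<close>, which is the tangent map in coordinates. The remainder is
  that of the derivative of \<open>Df\<close>, applied to \<open>w\<close>, plus \<open>D\<^sup>2f (y - x, w - v)\<close>, which is of second order.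
\<close>
lemma derivatives_on_has_second_derivative:
  assumes D: "derivatives_on D f S" and S: "open S" "x \<in> S"
  shows "((\<lambda>(y, w). D [w] y) has_derivative (\<lambda>(h, w). D [h, v] x + D [w] x)) (at (x, v))"
  unfolding has_derivative_at_alt
proof (intro conjI allI impI)
  note D' = derivatives_onD[OF D]
  obtain K1 where K1: "K1 > 0" "\<And>vs. length vs = 1 \<Longrightarrow> norm (D vs x) \<le> K1 * (\<Prod>v\<leftarrow>vs. norm v)"
    and lin1: "\<And>us ws. length us + 1 + length ws = 1 \<Longrightarrow> linear (\<lambda>v. D (us @ v # ws) x)"
    using D'(2)[OF S(2), of 1] by (rule bounded_multilinearE) (rule that)
  obtain K2 where K2: "K2 > 0" "\<And>vs. length vs = 2 \<Longrightarrow> norm (D vs x) \<le> K2 * (\<Prod>v\<leftarrow>vs. norm v)"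
    and lin2: "\<And>us ws. length us + 1 + length ws = 2 \<Longrightarrow> linear (\<lambda>v. D (us @ v # ws) x)"
    using D'(2)[OF S(2), of 2] by (rule bounded_multilinearE) (rule that)
  have l1: "linear (\<lambda>w. D [w] x)" using lin1[of "[]" "[]"] by simp
  have l2: "linear (\<lambda>h. D [h, w] x)" for w using lin2[of "[]" "[w]"] by simp
  have l2': "linear (\<lambda>w. D [h, w] x)" for h using lin2[of "[h]" "[]"] by simp
  have b1: "bounded_linear (\<lambda>w. D [w] x)"
    using l1 K1(2)[of "[_]"] by (intro bounded_linear.intro bounded_linear_axioms.intro exI[of _ K1]) (auto simp: mult.commute)
  have b2: "bounded_linear (\<lambda>h. D [h, v] x)"
    using l2 K2(2)[of "[_, v]"]
    by (intro bounded_linear.intro bounded_linear_axioms.intro exI[of _ "K2 * norm v"]) (auto simp: mult_ac)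
  have eq: "(\<lambda>(h, w). D [h, v] x + D [w] x) = (\<lambda>p. D [fst p, v] x + D [snd p] x)" by auto
  show "bounded_linear (\<lambda>(h, w). D [h, v] x + D [w] x)" unfolding eq
    by (intro bounded_linear_add bounded_linear_compose[OF b1] bounded_linear_compose[OF b2]
        bounded_linear_fst bounded_linear_snd)
  fix e :: real assume e: "e > 0"
  define C where "C = norm v + 1"
  have C: "C > 0" by (simp add: C_def add_nonneg_pos)
  define d where "d = min 1 (e / (2 * K2))"
  have d: "d > 0" using e K2 by (simp add: d_def)
  have "e / (2 * C) > 0" using e C by simp
  then obtain r where r: "r > 0"
    "\<And>y w. norm (y - x) < r \<Longrightarrow> norm (D [w] y - D [w] x - D [y - x, w] x) \<le> e / (2 * C) * norm (y - x) * norm w"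
    by (rule derivatives_on_approx_first[OF D S(2)]) (rule that)
  have "norm (D [w] y - D [v] x - (D [y - x, v] x + D [w - v] x)) \<le> e * norm ((y, w) - (x, v))"
    if *: "norm ((y, w) - (x, v)) < min r d" for y w
  proof -
    let ?n = "norm ((y, w) - (x, v))"
    have y: "norm (y - x) \<le> ?n" and w: "norm (w - v) \<le> ?n"
      using norm_fst_le[of "y - x" "w - v"] norm_snd_le[of "w - v" "y - x"] by auto
    have "norm w \<le> norm v + norm (w - v)" using norm_triangle_sub by blast
    then have wC: "norm w \<le> C" using w * by (auto simp: C_def d_def)
    have "norm (D [w] y - D [w] x - D [y - x, w] x) \<le> e / (2 * C) * norm (y - x) * norm w"
      using * y by (intro r) auto
    also have "\<dots> \<le> e / (2 * C) * ?n * C"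
      using y wC e C by (intro mult_mono) auto
    also have "\<dots> = e / 2 * ?n" using C by simp
    finally have A: "norm (D [w] y - D [w] x - D [y - x, w] x) \<le> e / 2 * ?n" .
    have "norm (D [y - x, w - v] x) \<le> K2 * (norm (y - x) * norm (w - v))"
      using K2(2)[of "[y - x, w - v]"] by simp
    also have "\<dots> \<le> K2 * (?n * (e / (2 * K2)))"
      using y w * K2(1) by (intro mult_mono) (auto simp: d_def)
    also have "\<dots> = e / 2 * ?n" using K2(1) by simp
    finally have B: "norm (D [y - x, w - v] x) \<le> e / 2 * ?n" .
    have "D [w] y - D [v] x - (D [y - x, v] x + D [w - v] x)
        = (D [w] y - D [w] x - D [y - x, w] x) + D [y - x, w - v] x"
      using linear_diff[OF l1] linear_diff[OF l2'] by (simp add: algebra_simps)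
    also have "norm \<dots> \<le> e / 2 * ?n + e / 2 * ?n"
      by (intro norm_triangle_mono A B)
    finally show ?thesis by simp
  qed
  then show "\<exists>d>0. \<forall>p. norm (p - (x, v)) < d \<longrightarrow>
     norm ((case p of (y, w) \<Rightarrow> D [w] y) - (case (x, v) of (y, w) \<Rightarrow> D [w] y)
        - (case p - (x, v) of (h, w) \<Rightarrow> D [h, v] x + D [w] x)) \<le> e * norm (p - (x, v))"
    using r(1) d by (intro exI[of _ "min r d"]) auto
qed

text \<open>
  Schwarz's theorem in normed spaces, by the mean value inequality applied to
  \<open>t \<mapsto> f (x + s (t a + b)) - f (x + s t a)\<close>: its increment over \<open>[0, 1]\<close> is a second difference that is
  symmetric in \<open>a\<close> and \<open>b\<close>.
\<close>
lemma derivatives_on_symmetric: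
  assumes D: "derivatives_on D f S" and S: "open S" "x \<in> S"
  shows "D [u, v] x = D [v, u] x"
proof -
  note D' = derivatives_onD[OF D]
  obtain K2 where K2: "K2 > 0" "\<And>vs. length vs = 2 \<Longrightarrow> norm (D vs x) \<le> K2 * (\<Prod>v\<leftarrow>vs. norm v)"
    and lin2: "\<And>us ws. length us + 1 + length ws = 2 \<Longrightarrow> linear (\<lambda>v. D (us @ v # ws) x)"
    using D'(2)[OF S(2), of 2] by (rule bounded_multilinearE) (rule that)
  have l2: "linear (\<lambda>h. D [h, w] x)" for w using lin2[of "[]" "[w]"] by simp
  have l2': "linear (\<lambda>w. D [h, w] x)" for h using lin2[of "[h]" "[]"] by simp
  have der: "(f has_derivative (\<lambda>h. D [h] y)) (at y)" if "y \<in> S" for y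
    by (rule derivatives_on_has_derivative[OF D S(1) that])
  obtain \<rho> where \<rho>: "\<rho> > 0" "ball x \<rho> \<subseteq> S" using S open_contains_ball by blast
  define C where "C = norm u + norm v + 1"
  have C: "C > 0" by (simp add: C_def add_nonneg_pos)
  define Q where "Q s = f (x + s *\<^sub>R (u + v)) - f (x + s *\<^sub>R u) - f (x + s *\<^sub>R v) + f x" for s :: real
  \<comment> \<open>As \<open>Q s\<close> is symmetric in \<open>u\<close> and \<open>v\<close>, the estimate is proved for both ways of calling one of them
      \<open>a\<close>, the direction of the segment, and the other one \<open>b\<close>, the shift.\<close>
  have key: "\<exists>r>0. \<forall>s. 0 < s \<and> s < r \<longrightarrow> norm (Q s - s^2 *\<^sub>R D [b, a] x) \<le> e * s^2"
    if "e > 0" and ab: "a = u \<and> b = v \<or> a = v \<and> b = u" for e :: real and a b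
  proof -
    have "e / (2 * C * C) > 0" using \<open>e > 0\<close> C by simp
    then obtain r where r: "r > 0"
      "\<And>y w. norm (y - x) < r \<Longrightarrow> norm (D [w] y - D [w] x - D [y - x, w] x) \<le> e / (2 * C * C) * norm (y - x) * norm w"
    by (rule derivatives_on_approx_first[OF D S(2)]) (rule that)
    have "norm (Q s - s^2 *\<^sub>R D [b, a] x) \<le> e * s^2" if s: "0 < s" "s < min r \<rho> / C" for s
    proof -
      have sC: "s * C < r" "s * C < \<rho>" using s C by (auto simp: field_simps)
      have nab: "norm a + norm b \<le> C" using ab by (auto simp: C_def)
      have in1: "norm (s *\<^sub>R (t *\<^sub>R a + b)) \<le> s * C" and in2: "norm (s *\<^sub>R (t *\<^sub>R a)) \<le> s * C"
        if "0 \<le> t" "t \<le> 1" for t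
      proof -
        have ta: "norm (t *\<^sub>R a) \<le> norm a" using that by (simp add: mult_left_le_one_le)
        then have "norm (t *\<^sub>R a + b) \<le> C" "norm (t *\<^sub>R a) \<le> C"
          using norm_triangle_ineq[of "t *\<^sub>R a" b] nab by (auto intro: order_trans norm_ge_zero)
             (smt (verit) norm_ge_zero)
        then show "norm (s *\<^sub>R (t *\<^sub>R a + b)) \<le> s * C" "norm (s *\<^sub>R (t *\<^sub>R a)) \<le> s * C"
          using s(1) by (auto simp del: scaleR_scaleR)
      qed
      have inS: "x + z \<in> S" if "norm z \<le> s * C" for z
        using \<rho>(2) that sC by (auto simp: dist_norm)
      define g where "g t = f (x + s *\<^sub>R (t *\<^sub>R a + b)) - f (x + s *\<^sub>R (t *\<^sub>R a)) - t *\<^sub>R (s^2 *\<^sub>R D [b, a] x)" for t :: real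
      define g' where "g' t h = D [s *\<^sub>R (h *\<^sub>R a)] (x + s *\<^sub>R (t *\<^sub>R a + b)) - D [s *\<^sub>R (h *\<^sub>R a)] (x + s *\<^sub>R (t *\<^sub>R a)) - h *\<^sub>R (s^2 *\<^sub>R D [b, a] x)" for t h :: real
      have "(g has_derivative g' t) (at t within {0..1})" if t: "t \<in> {0..1}" for t
      proof -
        have "((\<lambda>t. x + s *\<^sub>R (t *\<^sub>R a + b)) has_derivative (\<lambda>h. s *\<^sub>R (h *\<^sub>R a))) (at t within {0..1})"
          by (auto intro!: derivative_eq_intros)
        from has_derivative_compose[OF this der[OF inS[OF in1]]] t
        have 1: "((\<lambda>t. f (x + s *\<^sub>R (t *\<^sub>R a + b))) has_derivative (\<lambda>h. D [s *\<^sub>R (h *\<^sub>R a)] (x + s *\<^sub>R (t *\<^sub>R a + b)))) (at t within {0..1})"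
          by simp
        have "((\<lambda>t. x + s *\<^sub>R (t *\<^sub>R a)) has_derivative (\<lambda>h. s *\<^sub>R (h *\<^sub>R a))) (at t within {0..1})"
          by (auto intro!: derivative_eq_intros)
        from has_derivative_compose[OF this der[OF inS[OF in2]]] t
        have 2: "((\<lambda>t. f (x + s *\<^sub>R (t *\<^sub>R a))) has_derivative (\<lambda>h. D [s *\<^sub>R (h *\<^sub>R a)] (x + s *\<^sub>R (t *\<^sub>R a)))) (at t within {0..1})"
          by simp
        show ?thesis unfolding g_def g'_def
          by (intro has_derivative_diff 1 2) (auto intro!: derivative_eq_intros)
      qed
      moreover have "onorm (g' t) \<le> e * s^2" if t: "t \<in> {0..1}" for t
      proof (rule onorm_le)
        fix h :: real
        let ?w = "s *\<^sub>R (h *\<^sub>R a)"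
        have e1: "norm (D [?w] (x + z) - D [?w] x - D [z, ?w] x) \<le> e / 2 * s^2 * norm h"
          if "norm z \<le> s * C" for z
        proof -
          have "norm (D [?w] (x + z) - D [?w] x - D [z, ?w] x) \<le> e / (2 * C * C) * norm z * norm ?w"
            using r(2)[of "x + z" ?w] that sC by simp
          also have "\<dots> \<le> e / (2 * C * C) * (s * C) * (s * (norm h * C))"
          proof -
            have "norm a \<le> C" using nab by (smt (verit) norm_ge_zero)
            then have "norm ?w \<le> s * (norm h * C)" using s(1)
              by (simp add: abs_mult mult.assoc mult_left_mono)
            then show ?thesis using that \<open>e > 0\<close> C s(1) by (intro mult_mono) auto
          qed
          also have "\<dots> = e / 2 * s^2 * norm h" using C by (simp add: power2_eq_square)
          finally show ?thesis .
        qed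
        have "D [s *\<^sub>R (t *\<^sub>R a + b), ?w] x - D [s *\<^sub>R (t *\<^sub>R a), ?w] x = D [s *\<^sub>R b, ?w] x"
          using linear_diff[OF l2, of "s *\<^sub>R (t *\<^sub>R a + b)" "s *\<^sub>R (t *\<^sub>R a)"] by (simp add: scaleR_right_distrib)
        also have "\<dots> = h *\<^sub>R (s^2 *\<^sub>R D [b, a] x)"
          using linear_cmul[OF l2, of s b ?w] linear_cmul[OF l2', of b s "h *\<^sub>R a"] linear_cmul[OF l2', of b h a]
          by (simp add: power2_eq_square mult_ac)
        finally have *: "g' t h = (D [?w] (x + s *\<^sub>R (t *\<^sub>R a + b)) - D [?w] x - D [s *\<^sub>R (t *\<^sub>R a + b), ?w] x)
            - (D [?w] (x + s *\<^sub>R (t *\<^sub>R a)) - D [?w] x - D [s *\<^sub>R (t *\<^sub>R a), ?w] x)"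
          unfolding g'_def by (simp add: algebra_simps)
        have "norm (g' t h) \<le> e / 2 * s^2 * norm h + e / 2 * s^2 * norm h"
          unfolding * using t by (intro norm_triangle_le_diff add_mono e1 in1 in2) auto
        then show "norm (g' t h) \<le> e * s^2 * norm h" by (simp add: mult_ac)
      qed
      ultimately have "norm (g 1 - g 0) \<le> e * s^2 * norm (1 - 0 :: real)"
        by (intro differentiable_bound[where S = "{0..1}" and f' = g']) auto
      moreover have "g 1 - g 0 = Q s - s^2 *\<^sub>R D [b, a] x"
        using ab by (auto simp: g_def Q_def algebra_simps)
      ultimately show ?thesis by simp
    qed
    then show ?thesis using r(1) \<rho>(1) C by (intro exI[of _ "min r \<rho> / C"]) auto
  qed
  have "norm (D [v, u] x - D [u, v] x) \<le> e" if "e > 0" for e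
  proof -
    have e2: "e / 2 > 0" using that by simp
    obtain r1 where r1: "r1 > 0" "\<And>s. 0 < s \<Longrightarrow> s < r1 \<Longrightarrow> norm (Q s - s^2 *\<^sub>R D [v, u] x) \<le> e / 2 * s^2"
      using key[OF e2, of u v] by blast
    obtain r2 where r2: "r2 > 0" "\<And>s. 0 < s \<Longrightarrow> s < r2 \<Longrightarrow> norm (Q s - s^2 *\<^sub>R D [u, v] x) \<le> e / 2 * s^2"
      using key[OF e2, of v u] by blast
    define s where "s = min r1 r2 / 2"
    have s: "0 < s" "s < r1" "s < r2" using r1(1) r2(1) by (auto simp: s_def)
    have "s^2 *\<^sub>R (D [v, u] x - D [u, v] x) = (Q s - s^2 *\<^sub>R D [u, v] x) - (Q s - s^2 *\<^sub>R D [v, u] x)"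
      by (simp add: algebra_simps)
    also have "norm \<dots> \<le> e / 2 * s^2 + e / 2 * s^2"
      using s by (intro norm_triangle_le_diff add_mono r1 r2) auto
    finally have "s^2 * norm (D [v, u] x - D [u, v] x) \<le> s^2 * e" by (simp add: mult_ac)
    then show ?thesis using s by simp
  qed
  then have "norm (D [v, u] x - D [u, v] x) \<le> 0" by (rule field_le_epsilon) simp
  then show ?thesis by simp
qed

lemma smooth_on_differentiable:
  assumes "smooth_on f S" "x \<in> S"
  shows "f differentiable (at x)"
proof -
  obtain D where "open S" "derivatives_on D f S" using assms(1) by (rule smooth_onE)
  from derivatives_on_has_derivative[OF this(2,1) assms(2)] show ?thesis by (rule differentiableI)
qed

lemma smooth_on_second_derivative:
  assumes f: "smooth_on f S" and x: "x \<in> S"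
  obtains B where
    "\<And>v. ((\<lambda>(y, w). frechet_derivative f (at y) w) has_derivative
         (\<lambda>(h, w). B h v + frechet_derivative f (at x) w)) (at (x, v))"
    and "\<And>u v. B u v = B v u"
proof -
  obtain D where D: "open S" "derivatives_on D f S" using f by (rule smooth_onE)
  have fd: "frechet_derivative f (at y) = (\<lambda>h. D [h] y)" if "y \<in> S" for y
    using frechet_derivative_at[OF derivatives_on_has_derivative[OF D(2,1) that]] by (rule sym)
  have "((\<lambda>(y, w). frechet_derivative f (at y) w) has_derivative
         (\<lambda>(h, w). D [h, v] x + frechet_derivative f (at x) w)) (at (x, v))" for v
  proof -
    have "open (S \<times> (UNIV :: 'a set))" using D(1) by (intro open_Times) auto
    from derivatives_on_has_second_derivative[OF D(2,1) x, of v] this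
    have "((\<lambda>(y, w). frechet_derivative f (at y) w) has_derivative
         (\<lambda>(h, w). D [h, v] x + D [w] x)) (at (x, v))"
      by (rule has_derivative_transform_within_open) (use x in \<open>auto simp: fd\<close>)
    then show ?thesis using x by (simp add: fd)
  qed
  then show ?thesis using derivatives_on_symmetric[OF D(2,1) x] by (rule that)
qed

section \<open>Atlases with differentiable transitions\<close>

lemma has_derivative_eventually_eq:
  assumes "(f has_derivative L) (at x)" "\<forall>\<^sub>F y in nhds x. f y = g y"
  shows "(g has_derivative L) (at x)"
  using assms unfolding eventually_nhds by (blast intro: has_derivative_transform_within_open)

text \<open>
  A notion that is inherited by the tangent bundle at the cost of one derivative. It is enough to show
  that a smooth map is differentiable in all charts, and thus serves for maps into and between tangent
  bundles without a proof that these are smooth manifolds.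
\<close>
locale differentiable_atlas =
  fixes A :: "('m, 'e::real_normed_vector) atlas"
  assumes chart_inj: "c \<in> A \<Longrightarrow> inj_on (snd c) (fst c)"
    and chart_open: "c \<in> A \<Longrightarrow> open (snd c ` fst c)"
    and overlap_open: "c \<in> A \<Longrightarrow> d \<in> A \<Longrightarrow> open (snd c ` (fst c \<inter> fst d))"
    and transition_differentiable:
      "c \<in> A \<Longrightarrow> d \<in> A \<Longrightarrow> m \<in> fst c \<Longrightarrow> m \<in> fst d \<Longrightarrow>
        transition c d differentiable (at (snd c m))"

lemma banach_manifold_imp_differentiable_atlas:
  assumes "banach_manifold A"
  shows "differentiable_atlas A"
proof -
  interpret banach_manifold A by (rule assms)
  show ?thesis
    by unfold_locales (auto intro!: chart_inj chart_open overlap_open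
        smooth_on_differentiable[OF transition_smooth])
qed

lemma charts_at_iff: "c \<in> charts_at A m \<longleftrightarrow> c \<in> A \<and> m \<in> fst c"
  by (simp add: charts_at_def)

lemma charts_at_ex: "m \<in> carrier A \<Longrightarrow> \<exists>c. c \<in> charts_at A m"
  by (auto simp: carrier_def charts_at_def)

abbreviation transition_derivative ::
  "('m, 'e::real_normed_vector) chart \<Rightarrow> ('m, 'e) chart \<Rightarrow> 'm \<Rightarrow> 'e \<Rightarrow> 'e" where
  "transition_derivative c d m \<equiv> frechet_derivative (transition c d) (at (snd c m))"

text \<open>
  The inverse of the evaluation isomorphism \<open>v \<mapsto> v c\<close> from the tangent space to the model space.
\<close>
definition tangent_of ::
  "('m, 'e::real_normed_vector) atlas \<Rightarrow> ('m, 'e) chart \<Rightarrow> 'm \<Rightarrow> 'e \<Rightarrow> ('m, 'e) tvec" where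
  "tangent_of A c m e = (\<lambda>d. if d \<in> charts_at A m then transition_derivative c d m e else 0)"

context differentiable_atlas
begin

lemma chart_inv_chart: "c \<in> A \<Longrightarrow> m \<in> fst c \<Longrightarrow> chart_inv c (snd c m) = m"
  unfolding chart_inv_def by (simp add: chart_inj)

lemma transition_chart: "c \<in> A \<Longrightarrow> m \<in> fst c \<Longrightarrow> transition c d (snd c m) = snd d m"
  by (simp add: transition_def chart_inv_chart)

lemma transition_has_derivative:
  assumes "c \<in> charts_at A m" "d \<in> charts_at A m"
  shows "(transition c d has_derivative transition_derivative c d m) (at (snd c m))"
  using transition_differentiable assms by (auto simp: charts_at_iff frechet_derivative_works)

lemma manifold_open_image: "manifold_open A W \<Longrightarrow> c \<in> A \<Longrightarrow> W \<subseteq> fst c \<Longrightarrow> open (snd c ` W)"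
  unfolding manifold_open_def by (metis inf.absorb2)

lemma manifold_open_chart: "c \<in> A \<Longrightarrow> manifold_open A (fst c)"
  unfolding manifold_open_def carrier_def using overlap_open by auto

lemma manifold_open_Int:
  assumes "manifold_open A W" "manifold_open A W'"
  shows "manifold_open A (W \<inter> W')"
  unfolding manifold_open_def
proof (intro conjI ballI)
  show "W \<inter> W' \<subseteq> carrier A" using assms by (auto simp: manifold_open_def)
  fix c assume c: "c \<in> A"
  have "snd c ` (fst c \<inter> (W \<inter> W')) = snd c ` ((fst c \<inter> W) \<inter> (fst c \<inter> W'))"
    by (rule arg_cong[of _ _ "(`) (snd c)"]) auto
  also have "\<dots> = snd c ` (fst c \<inter> W) \<inter> snd c ` (fst c \<inter> W')"
    by (rule inj_on_image_Int[OF chart_inj[OF c]]) auto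
  finally show "open (snd c ` (fst c \<inter> (W \<inter> W')))" using assms c by (auto simp: manifold_open_def)
qed

lemma manifold_openI:
  assumes c: "c \<in> A" and W: "W \<subseteq> fst c" "open (snd c ` W)"
  shows "manifold_open A W"
  unfolding manifold_open_def
proof (intro conjI ballI)
  show "W \<subseteq> carrier A" using c W by (auto simp: carrier_def)
  fix d assume d: "d \<in> A"
  let ?O = "snd d ` (fst d \<inter> fst c)"
  have "snd d ` (fst d \<inter> W) = ?O \<inter> transition d c -` (snd c ` W)"
  proof (intro equalityI subsetI)
    fix p assume "p \<in> snd d ` (fst d \<inter> W)"
    then show "p \<in> ?O \<inter> transition d c -` (snd c ` W)"
      using W(1) d by (auto simp: transition_chart)
  next
    fix p assume "p \<in> ?O \<inter> transition d c -` (snd c ` W)"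
    then obtain m m' where m: "p = snd d m" "m \<in> fst d" "m \<in> fst c" "m' \<in> W" "snd c m = snd c m'"
      using d by (auto simp: transition_chart)
    then have "m = m'" using chart_inj[OF c] W(1) by (auto dest: inj_onD)
    then show "p \<in> snd d ` (fst d \<inter> W)" using m by auto
  qed
  moreover have "continuous_on ?O (transition d c)"
    using transition_differentiable[OF d c]
    by (intro continuous_at_imp_continuous_on) (blast intro: differentiable_imp_continuous_within)
  ultimately show "open (snd d ` (fst d \<inter> W))"
    using continuous_open_preimage[OF _ overlap_open[OF d c] W(2)] by simp
qed

lemma eventually_chart_inv_in:
  assumes c: "c \<in> charts_at A m" and W: "manifold_open A W" "m \<in> W"
  shows "\<forall>\<^sub>F p in nhds (snd c m). snd c (chart_inv c p) = p \<and> chart_inv c p \<in> fst c \<inter> W"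
proof -
  have "open (snd c ` (fst c \<inter> W))" "snd c m \<in> snd c ` (fst c \<inter> W)"
    using assms by (auto simp: manifold_open_def charts_at_iff)
  from eventually_nhds_in_open[OF this] show ?thesis
    by eventually_elim (use c in \<open>auto simp: charts_at_iff chart_inv_chart\<close>)
qed

text \<open>
  The cocycle condition, which makes \<open>tangent_of\<close> a tangent vector.
\<close>
lemma transition_derivative_compose:
  assumes "c \<in> charts_at A m" "d \<in> charts_at A m" "e \<in> charts_at A m"
  shows "transition_derivative d e m (transition_derivative c d m v) = transition_derivative c e m v"
proof -
  have "(transition d e has_derivative transition_derivative d e m) (at (transition c d (snd c m)))"
    using transition_has_derivative[OF assms(2,3)] assms(1) by (simp add: transition_chart charts_at_iff)
  from diff_chain_at[OF transition_has_derivative[OF assms(1,2)] this]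
  have "((transition d e \<circ> transition c d) has_derivative (transition_derivative d e m \<circ> transition_derivative c d m)) (at (snd c m))" .
  moreover have "\<forall>\<^sub>F p in nhds (snd c m). (transition d e \<circ> transition c d) p = transition c e p"
    using eventually_chart_inv_in[OF assms(1) manifold_open_chart[of d]] assms
    by (auto elim!: eventually_mono simp: charts_at_iff transition_def chart_inv_chart)
  ultimately have "(transition c e has_derivative (transition_derivative d e m \<circ> transition_derivative c d m)) (at (snd c m))"
    by (rule has_derivative_eventually_eq)
  from frechet_derivative_at[OF this] show ?thesis by (metis o_apply)
qed

lemma transition_derivative_same:
  assumes "c \<in> charts_at A m"
  shows "transition_derivative c c m v = v"
proof -
  have "((\<lambda>p. p) has_derivative (\<lambda>p. p)) (at (snd c m))" by (rule has_derivative_ident)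
  moreover have "open (snd c ` fst c)" "snd c m \<in> snd c ` fst c" using assms chart_open by (auto simp: charts_at_iff)
  moreover have "p = transition c c p" if "p \<in> snd c ` fst c" for p
    using that assms by (auto simp: charts_at_iff transition_chart)
  ultimately have "(transition c c has_derivative (\<lambda>p. p)) (at (snd c m))"
    by (rule has_derivative_transform_within_open)
  from frechet_derivative_at[OF this] show ?thesis by metis
qed

lemma linear_transition_derivative:
  "c \<in> charts_at A m \<Longrightarrow> d \<in> charts_at A m \<Longrightarrow> linear (transition_derivative c d m)"
  using transition_has_derivative has_derivative_linear by blast

lemma tangent_space_transition:
  "v \<in> tangent_space A m \<Longrightarrow> c \<in> charts_at A m \<Longrightarrow> d \<in> charts_at A m \<Longrightarrow>
    v d = transition_derivative c d m (v c)"
  unfolding tangent_space_def by blast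

lemma tangent_space_off: "v \<in> tangent_space A m \<Longrightarrow> c \<notin> charts_at A m \<Longrightarrow> v c = 0"
  unfolding tangent_space_def by blast

lemma tangent_eqI:
  assumes "v \<in> tangent_space A m" "w \<in> tangent_space A m" "c \<in> charts_at A m" "v c = w c"
  shows "v = w"
proof
  fix d show "v d = w d"
  proof (cases "d \<in> charts_at A m")
    case True
    then show ?thesis using assms(4) tangent_space_transition[OF assms(1,3) True]
        tangent_space_transition[OF assms(2,3) True] by simp
  next
    case False
    then show ?thesis using tangent_space_off[OF assms(1) False] tangent_space_off[OF assms(2) False] by simp
  qed
qed

lemma tangent_spaceI:
  assumes c: "c \<in> charts_at A m" and "\<And>d. d \<in> charts_at A m \<Longrightarrow> v d = transition_derivative c d m (v c)"
    "\<And>d. d \<notin> charts_at A m \<Longrightarrow> v d = 0"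
  shows "v \<in> tangent_space A m"
proof -
  have *: "v e = transition_derivative d e m (v d)" if "d \<in> charts_at A m" "e \<in> charts_at A m" for d e
    using transition_derivative_compose[OF c that] assms(2) that by simp
  show ?thesis unfolding tangent_space_def
    by (intro CollectI conjI ballI allI impI) (rule *, assumption+, rule assms(3))
qed

lemma tangent_of_in: "c \<in> charts_at A m \<Longrightarrow> tangent_of A c m e \<in> tangent_space A m"
  by (rule tangent_spaceI[of c]) (auto simp: tangent_of_def transition_derivative_same)

lemma tangent_of_same [simp]: "c \<in> charts_at A m \<Longrightarrow> tangent_of A c m e c = e"
  by (auto simp: tangent_of_def transition_derivative_same)

lemma tangent_of_eq: "v \<in> tangent_space A m \<Longrightarrow> c \<in> charts_at A m \<Longrightarrow> tangent_of A c m (v c) = v"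
  by (rule tangent_eqI[OF tangent_of_in]) auto

lemma tangent_space_add:
  assumes v: "v \<in> tangent_space A m" and w: "w \<in> tangent_space A m"
  shows "v + w \<in> tangent_space A m"
  unfolding tangent_space_def
proof (intro CollectI conjI ballI allI impI)
  fix c d assume c: "c \<in> charts_at A m" and d: "d \<in> charts_at A m"
  show "(v + w) d = transition_derivative c d m ((v + w) c)"
    using tangent_space_transition[OF v c d] tangent_space_transition[OF w c d]
    by (simp add: linear_add[OF linear_transition_derivative[OF c d]])
next
  fix c assume "c \<notin> charts_at A m"
  then show "(v + w) c = 0" using tangent_space_off[OF v] tangent_space_off[OF w] by simp
qed

lemma tangent_space_diff:
  assumes v: "v \<in> tangent_space A m" and w: "w \<in> tangent_space A m"
  shows "v - w \<in> tangent_space A m"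
  unfolding tangent_space_def
proof (intro CollectI conjI ballI allI impI)
  fix c d assume c: "c \<in> charts_at A m" and d: "d \<in> charts_at A m"
  show "(v - w) d = transition_derivative c d m ((v - w) c)"
    using tangent_space_transition[OF v c d] tangent_space_transition[OF w c d]
    by (simp add: linear_diff[OF linear_transition_derivative[OF c d]])
next
  fix c assume "c \<notin> charts_at A m"
  then show "(v - w) c = 0" using tangent_space_off[OF v] tangent_space_off[OF w] by simp
qed

lemma tangent_space_zero: "0 \<in> tangent_space A m"
  unfolding tangent_space_def
  by (simp add: linear_0[OF linear_transition_derivative])

lemma tangent_space_minus: "v \<in> tangent_space A m \<Longrightarrow> - v \<in> tangent_space A m"
  using tangent_space_diff[OF tangent_space_zero] by simp

end

lemma smooth_map_onE:
  assumes "smooth_map_on A B W f" "m \<in> W"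
  obtains c d W' where "c \<in> A" "d \<in> B" "manifold_open A W'" "m \<in> W'" "W' \<subseteq> fst c" "W' \<subseteq> W"
    "f ` W' \<subseteq> fst d" "smooth_on (snd d \<circ> f \<circ> chart_inv c) (snd c ` W')"
proof -
  from bspec[OF assms(1)[unfolded smooth_map_on_def] assms(2)]
  obtain c d W' where "c \<in> A" "d \<in> B" and *: "manifold_open A W' \<and> m \<in> W' \<and> W' \<subseteq> fst c \<inter> W \<and>
        f ` W' \<subseteq> fst d \<and> smooth_on (snd d \<circ> f \<circ> chart_inv c) (snd c ` W')"
    by (elim bexE exE)
  then show ?thesis by (intro that[of c d W']) simp_all
qed

text \<open>
  \<open>smooth_map_on\<close> speaks of one chart near each point of the source and one in the target; differentiability
  in all others follows by composing with transition maps.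
\<close>
lemma smooth_map_rep_differentiable:
  fixes A :: "('m, 'e::real_normed_vector) atlas" and B :: "('k, 'f::real_normed_vector) atlas"
  assumes "differentiable_atlas A" "differentiable_atlas B"
    and f: "smooth_map_on A B W f" "m \<in> W" and c: "c \<in> charts_at A m" and d: "d \<in> charts_at B (f m)"
  shows "(snd d \<circ> f \<circ> chart_inv c) differentiable (at (snd c m))"
proof -
  interpret A: differentiable_atlas A by fact
  interpret B: differentiable_atlas B by fact
  obtain c' d' W' where 1: "c' \<in> A" "d' \<in> B" "manifold_open A W'" "m \<in> W'" "W' \<subseteq> fst c'" "W' \<subseteq> W" "f ` W' \<subseteq> fst d'"
    "smooth_on (snd d' \<circ> f \<circ> chart_inv c') (snd c' ` W')"
    using f by (rule smooth_map_onE)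
  have c': "c' \<in> charts_at A m" and d': "d' \<in> charts_at B (f m)" using 1 by (auto simp: charts_at_iff)
  have t1: "transition c c' differentiable (at (snd c m))"
    using A.transition_has_derivative[OF c c'] by (rule differentiableI)
  have "(snd d' \<circ> f \<circ> chart_inv c') differentiable (at (snd c' m))"
    using 1 by (intro smooth_on_differentiable[OF 1(8)]) auto
  then have t2: "(snd d' \<circ> f \<circ> chart_inv c') differentiable (at (transition c c' (snd c m)))"
    using c by (simp add: charts_at_iff A.transition_chart)
  have "transition d' d differentiable (at (snd d' (f m)))"
    using B.transition_has_derivative[OF d' d] by (rule differentiableI)
  then have t3: "transition d' d differentiable (at (((snd d' \<circ> f \<circ> chart_inv c') \<circ> transition c c') (snd c m)))"
    using c c' by (simp add: charts_at_iff A.transition_chart A.chart_inv_chart)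
  have "(transition d' d \<circ> ((snd d' \<circ> f \<circ> chart_inv c') \<circ> transition c c')) differentiable (at (snd c m))"
    by (intro differentiable_chain_at t1 t2 t3)
  then obtain L where L: "((transition d' d \<circ> ((snd d' \<circ> f \<circ> chart_inv c') \<circ> transition c c')) has_derivative L) (at (snd c m))"
    by (auto simp: differentiable_def)
  let ?O = "snd c ` (fst c \<inter> W')"
  have "((snd d \<circ> f \<circ> chart_inv c) has_derivative L) (at (snd c m))"
  proof (rule has_derivative_transform_within_open[OF L])
    show "open ?O" using 1(3) c by (auto simp: manifold_open_def charts_at_iff)
    show "snd c m \<in> ?O" using c 1 by (auto simp: charts_at_iff)
    fix p assume "p \<in> ?O"
    then show "(transition d' d \<circ> ((snd d' \<circ> f \<circ> chart_inv c') \<circ> transition c c')) p = (snd d \<circ> f \<circ> chart_inv c) p"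
      using c 1 by (auto simp: charts_at_iff A.transition_chart A.chart_inv_chart B.transition_chart image_subset_iff subset_iff)
  qed
  then show ?thesis by (rule differentiableI)
qed

section \<open>The atlas of the tangent bundle\<close>

lemma fst_tangent_chart: "fst (tangent_chart A c) = (SIGMA m:fst c. tangent_space A m)"
  and snd_tangent_chart: "snd (tangent_chart A c) (m, v) = (snd c m, v c)"
  by (auto simp: tangent_chart_def)

lemma charts_at_tangent_bundle: "c \<in> charts_at A m \<Longrightarrow> v \<in> tangent_space A m \<Longrightarrow> tangent_chart A c \<in> charts_at (tangent_bundle A) (m, v)"
  by (auto simp: charts_at_iff tangent_bundle_def fst_tangent_chart)

lemma carrier_tangent_bundle: "carrier (tangent_bundle A) = (SIGMA m:carrier A. tangent_space A m)"
  by (auto simp: carrier_def tangent_bundle_def fst_tangent_chart)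

lemma (in differentiable_atlas) inj_on_tangent_chart:
  assumes "c \<in> A" shows "inj_on (snd (tangent_chart A c)) (fst (tangent_chart A c))"
proof (rule inj_onI)
  fix x y assume xy: "x \<in> fst (tangent_chart A c)" "y \<in> fst (tangent_chart A c)"
    "snd (tangent_chart A c) x = snd (tangent_chart A c) y"
  then have "fst x = fst y"
    using inj_onD[OF chart_inj[OF assms]] by (auto simp: fst_tangent_chart snd_tangent_chart)
  moreover from this have "snd x = snd y" using xy assms
    by (intro tangent_eqI[of _ "fst x" _ c]) (auto simp: fst_tangent_chart snd_tangent_chart charts_at_iff)
  ultimately show "x = y" by (rule prod_eqI)
qed

lemma (in differentiable_atlas) tangent_chart_image:
  assumes "c \<in> A" "S \<subseteq> fst c"
  shows "snd (tangent_chart A c) ` (SIGMA m:S. tangent_space A m) = (snd c ` S) \<times> UNIV"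
proof (intro equalityI subsetI)
  fix x assume "x \<in> (snd c ` S) \<times> (UNIV :: 'e set)"
  then obtain m e where m: "x = (snd c m, e)" "m \<in> S" by auto
  then have "c \<in> charts_at A m" using assms by (auto simp: charts_at_iff)
  then have "x = snd (tangent_chart A c) (m, tangent_of A c m e)" "tangent_of A c m e \<in> tangent_space A m"
    by (auto simp: m snd_tangent_chart tangent_of_in)
  then show "x \<in> snd (tangent_chart A c) ` (SIGMA m:S. tangent_space A m)" using m(2) by blast
qed (auto simp: snd_tangent_chart)

lemma (in differentiable_atlas) chart_inv_tangent_chart:
  assumes "c \<in> A" "p \<in> snd c ` fst c"
  shows "chart_inv (tangent_chart A c) (p, e) = (chart_inv c p, tangent_of A c (chart_inv c p) e)"
proof -
  let ?m = "chart_inv c p"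
  have c: "c \<in> charts_at A ?m" and p: "snd c ?m = p" using assms by (auto simp: charts_at_iff chart_inv_chart)
  have "chart_inv (tangent_chart A c) (snd (tangent_chart A c) (?m, tangent_of A c ?m e)) = (?m, tangent_of A c ?m e)"
    unfolding chart_inv_def[of "tangent_chart A c"]
    by (rule inv_into_f_f[OF inj_on_tangent_chart[OF assms(1)]])
       (use c in \<open>auto simp: fst_tangent_chart charts_at_iff tangent_of_in\<close>)
  then show ?thesis using c p by (simp add: snd_tangent_chart)
qed

text \<open>
  In coordinates the transition maps of the tangent bundle are \<open>(p, v) \<mapsto> (\<phi> p, D\<phi>\<^sub>p v)\<close> with \<open>\<phi>\<close> a
  transition map of \<open>A\<close>, so their differentiability is that of the first derivative of \<open>\<phi>\<close>.
\<close>
lemma differentiable_atlas_tangent_bundle: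
  assumes "banach_manifold A"
  shows "differentiable_atlas (tangent_bundle A)"
proof -
  interpret banach_manifold A by fact
  interpret d: differentiable_atlas A by (rule banach_manifold_imp_differentiable_atlas) fact
  show ?thesis
  proof
    fix C D assume C: "C \<in> tangent_bundle A" and D: "D \<in> tangent_bundle A"
    then obtain c d where c: "c \<in> A" "C = tangent_chart A c" and d: "d \<in> A" "D = tangent_chart A d"
      by (auto simp: tangent_bundle_def)
    show "inj_on (snd C) (fst C)" using d.inj_on_tangent_chart c by simp
    show "open (snd C ` fst C)"
      unfolding c(2) fst_tangent_chart d.tangent_chart_image[OF c(1) order_refl]
      using chart_open[OF c(1)] by (intro open_Times) auto
    have *: "fst C \<inter> fst D = (SIGMA m:fst c \<inter> fst d. tangent_space A m)"
      by (auto simp: c d fst_tangent_chart)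
    show "open (snd C ` (fst C \<inter> fst D))"
      unfolding * unfolding c(2) using overlap_open[OF c(1) d(1)] c(1)
      by (subst d.tangent_chart_image) (auto intro!: open_Times)
    fix M assume M: "M \<in> fst C" "M \<in> fst D"
    obtain m v where m: "M = (m, v)" "m \<in> fst c" "m \<in> fst d" "v \<in> tangent_space A m"
      using M by (auto simp: c d fst_tangent_chart)
    let ?O = "snd c ` (fst c \<inter> fst d)"
    have sm: "smooth_on (transition c d) ?O" using transition_smooth c d by simp
    have mO: "snd c m \<in> ?O" using m by auto
    obtain B where B: "\<And>v. ((\<lambda>(y, w). frechet_derivative (transition c d) (at y) w) has_derivative
         (\<lambda>(h, w). B h v + frechet_derivative (transition c d) (at (snd c m)) w)) (at (snd c m, v))"
      using smooth_on_second_derivative[OF sm mO] by metis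
    have 1: "(\<lambda>(y, w). frechet_derivative (transition c d) (at y) w) differentiable (at (snd c m, v c))"
      using B by (rule differentiableI)
    have "(transition c d \<circ> fst) differentiable (at (snd c m, v c))"
      using smooth_on_differentiable[OF sm mO]
      by (intro differentiable_chain_at) (auto intro: bounded_linear_imp_differentiable bounded_linear_fst)
    then have "(\<lambda>x. (transition c d (fst x), (\<lambda>(y, w). frechet_derivative (transition c d) (at y) w) x)) differentiable (at (snd c m, v c))"
      using 1 by (auto simp: differentiable_def o_def intro: has_derivative_Pair)
    then obtain L where L: "((\<lambda>x. (transition c d (fst x), (\<lambda>(y, w). frechet_derivative (transition c d) (at y) w) x)) has_derivative L) (at (snd c m, v c))"
      by (auto simp: differentiable_def)
    have "(transition C D has_derivative L) (at (snd c m, v c))"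
    proof (rule has_derivative_transform_within_open[OF L])
      show "open (?O \<times> (UNIV :: 'b set))" using overlap_open c d by (intro open_Times) auto
      show "(snd c m, v c) \<in> ?O \<times> UNIV" using mO by simp
      fix x assume "x \<in> ?O \<times> (UNIV :: 'b set)"
      then obtain n e where x: "x = (snd c n, e)" "n \<in> fst c" "n \<in> fst d" by auto
      show "(transition c d (fst x), (\<lambda>(y, w). frechet_derivative (transition c d) (at y) w) x) = transition C D x"
        using x c d by (simp add: transition_def[of "tangent_chart A c"] d.chart_inv_tangent_chart d.chart_inv_chart
            d.transition_chart snd_tangent_chart tangent_of_def charts_at_iff)
    qed
    then show "transition C D differentiable (at (snd C M))"
      by (auto simp: c m snd_tangent_chart intro: differentiableI)
  qed
qed

section \<open>Vector fields and brackets in charts\<close>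

text \<open>
  \<open>\<phi>\<close> maps brackets to brackets, also for fields \<open>x\<close>, \<open>y\<close> that are not \<open>\<phi>\<close>-related to fields on the target:
  the push-forward \<open>\<xi> = D\<phi> x\<close> is only a field along \<open>\<phi>\<close>, and its derivative in direction \<open>y\<close> is
  \<open>D\<^sup>2\<phi> (y, x) + D\<phi> (x' y)\<close>, where the first term is symmetric in \<open>x\<close> and \<open>y\<close>.
\<close>
lemma smooth_on_bracket:
  assumes \<phi>: "smooth_on \<phi> S" "p \<in> S"
    and x: "(x has_derivative x') (at p)" and y: "(y has_derivative y') (at p)"
    and \<xi>: "((\<lambda>q. frechet_derivative \<phi> (at q) (x q)) has_derivative \<xi>') (at p)"
    and \<eta>: "((\<lambda>q. frechet_derivative \<phi> (at q) (y q)) has_derivative \<eta>') (at p)"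
  shows "\<xi>' (y p) - \<eta>' (x p) = frechet_derivative \<phi> (at p) (x' (y p) - y' (x p))"
proof -
  let ?D = "frechet_derivative \<phi> (at p)"
  obtain B where B: "\<And>v. ((\<lambda>(y, w). frechet_derivative \<phi> (at y) w) has_derivative
         (\<lambda>(h, w). B h v + ?D w)) (at (p, v))" and sym: "\<And>u v. B u v = B v u"
    using \<phi> by (rule smooth_on_second_derivative) (rule that)
  have 1: "((\<lambda>q. frechet_derivative \<phi> (at q) (z q)) has_derivative (\<lambda>h. B h (z p) + ?D (z' h))) (at p)"
    if z: "(z has_derivative z') (at p)" for z z'
    using has_derivative_compose[OF has_derivative_Pair[OF has_derivative_ident z] B] by simp
  have "\<xi>' = (\<lambda>h. B h (x p) + ?D (x' h))" using has_derivative_unique[OF \<xi> 1[OF x]] .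
  moreover have "\<eta>' = (\<lambda>h. B h (y p) + ?D (y' h))" using has_derivative_unique[OF \<eta> 1[OF y]] .
  moreover have "linear ?D"
    using smooth_on_differentiable[OF \<phi>] by (rule linear_frechet_derivative)
  ultimately show ?thesis using sym[of "x p" "y p"] by (simp add: linear_diff)
qed

lemma smooth_on_pushforward_differentiable:
  assumes \<phi>: "smooth_on \<phi> S" "p \<in> S" and x: "x differentiable (at p)"
  shows "(\<lambda>q. frechet_derivative \<phi> (at q) (x q)) differentiable (at p)"
proof -
  obtain B where B: "\<And>v. ((\<lambda>(y, w). frechet_derivative \<phi> (at y) w) has_derivative
         (\<lambda>(h, w). B h v + frechet_derivative \<phi> (at p) w)) (at (p, v))"
    using \<phi> by (rule smooth_on_second_derivative) (rule that)
  obtain x' where x': "(x has_derivative x') (at p)" using x by (auto simp: differentiable_def)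
  show ?thesis
    using has_derivative_compose[OF has_derivative_Pair[OF has_derivative_ident x'] B[of "x p"]]
    by (auto intro: differentiableI)
qed

abbreviation map_rep ::
  "('m, 'e) chart \<Rightarrow> ('k, 'f) chart \<Rightarrow> ('m \<Rightarrow> 'k) \<Rightarrow> 'e \<Rightarrow> 'f" where
  "map_rep c d f \<equiv> snd d \<circ> f \<circ> chart_inv c"

text \<open>
  What a bracket at \<open>m\<close> needs. For \<open>NX\<close> this follows from the chain rule for Frechet derivatives, whereas
  smoothness of \<open>NX\<close> would need a chain rule for \<open>smooth_on\<close>.
\<close>
definition differentiable_field_at ::
  "('m, 'e::real_normed_vector) atlas \<Rightarrow> 'm \<Rightarrow> ('m \<Rightarrow> ('m, 'e) tvec) \<Rightarrow> bool" where
  "differentiable_field_at A m X \<longleftrightarrow>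
     (\<exists>W. manifold_open A W \<and> m \<in> W \<and> (\<forall>q\<in>W. X q \<in> tangent_space A q)) \<and>
     (\<forall>c\<in>charts_at A m. local_rep X c differentiable (at (snd c m)))"

sublocale banach_manifold \<subseteq> atlas: differentiable_atlas A
  by (rule banach_manifold_imp_differentiable_atlas) unfold_locales

lemma charts_at_imp_carrier: "c \<in> charts_at A m \<Longrightarrow> m \<in> carrier A"
  by (auto simp: charts_at_iff carrier_def)

context banach_manifold
begin

lemma manifold_open_carrier: "manifold_open A W \<Longrightarrow> m \<in> W \<Longrightarrow> m \<in> carrier A"
  by (auto simp: manifold_open_def)

lemma tangent_bundle_atlas: "differentiable_atlas (tangent_bundle A)"
  by (rule differentiable_atlas_tangent_bundle) unfold_locales

lemma tangent_at_chart_inv: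
  assumes "differentiable_field_at A m X" "c \<in> charts_at A m"
  shows "\<forall>\<^sub>F p in nhds (snd c m). snd c (chart_inv c p) = p \<and> c \<in> charts_at A (chart_inv c p) \<and>
    X (chart_inv c p) \<in> tangent_space A (chart_inv c p)"
proof -
  obtain W where "manifold_open A W" "m \<in> W" "\<forall>q\<in>W. X q \<in> tangent_space A q"
    using assms(1) unfolding differentiable_field_at_def by blast
  from atlas.eventually_chart_inv_in[OF assms(2) this(1,2)] this(3) show ?thesis
    using assms(2) by (auto elim!: eventually_mono simp: charts_at_iff)
qed

lemma local_rep_has_derivative:
  assumes "differentiable_field_at A m X" "c \<in> charts_at A m"
  shows "(local_rep X c has_derivative frechet_derivative (local_rep X c) (at (snd c m))) (at (snd c m))"
  using assms unfolding differentiable_field_at_def by (simp add: frechet_derivative_works[symmetric])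

lemma differentiable_field_at_tangent:
  "differentiable_field_at A m X \<Longrightarrow> X m \<in> tangent_space A m"
  unfolding differentiable_field_at_def by blast

lemma local_rep_chart: "c \<in> charts_at A m \<Longrightarrow> local_rep X c (snd c m) = X m c"
  by (simp add: local_rep_def atlas.chart_inv_chart charts_at_iff)

lemma vector_field_on_imp_differentiable_field_at:
  assumes W: "manifold_open A W" "m \<in> W" and X: "vector_field_on A W X"
  shows "differentiable_field_at A m X"
  unfolding differentiable_field_at_def
proof (intro conjI ballI)
  show "\<exists>W. manifold_open A W \<and> m \<in> W \<and> (\<forall>q\<in>W. X q \<in> tangent_space A q)"
    using assms by (auto simp: vector_field_on_def)
  fix c assume c: "c \<in> charts_at A m"
  have sm: "smooth_map_on A (tangent_bundle A) W (\<lambda>m. (m, X m))" and Xm: "X m \<in> tangent_space A m"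
    using X W by (auto simp: vector_field_on_def)
  have "map_rep c (tangent_chart A c) (\<lambda>m. (m, X m)) differentiable (at (snd c m))"
    by (rule smooth_map_rep_differentiable[OF _ tangent_bundle_atlas sm W(2) c charts_at_tangent_bundle[OF c Xm]])
       unfold_locales
  then have "(snd \<circ> map_rep c (tangent_chart A c) (\<lambda>m. (m, X m))) differentiable (at (snd c m))"
    by (intro differentiable_chain_at) (auto intro: bounded_linear_imp_differentiable bounded_linear_snd)
  moreover have "snd \<circ> map_rep c (tangent_chart A c) (\<lambda>m. (m, X m)) = local_rep X c"
    by (auto simp: local_rep_def snd_tangent_chart)
  ultimately show "local_rep X c differentiable (at (snd c m))" by simp
qed

text \<open>
  The bracket does not depend on the chart: this is \<open>smooth_on_bracket\<close> for a transition map \<open>\<phi>\<close>, where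
  the push-forward of a field is its representation in the other chart, composed with \<open>\<phi>\<close>.
\<close>
lemma lie_bracket_tangent:
  assumes m: "m \<in> carrier A" and X: "differentiable_field_at A m X" and Y: "differentiable_field_at A m Y"
  shows "lie_bracket A X Y m \<in> tangent_space A m"
proof -
  obtain c where c: "c \<in> charts_at A m" using charts_at_ex[OF m] by blast
  show ?thesis
  proof (rule atlas.tangent_spaceI[OF c])
    show "lie_bracket A X Y m d = 0" if "d \<notin> charts_at A m" for d using that by (simp add: lie_bracket_def)
    fix d assume d: "d \<in> charts_at A m"
    let ?S = "snd c ` (fst c \<inter> fst d)" let ?p = "snd c m" let ?T = "transition c d"
    have sm: "smooth_on ?T ?S" using transition_smooth c d by (simp add: charts_at_iff)
    have pS: "?p \<in> ?S" using c d by (auto simp: charts_at_iff)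
    have push: "((\<lambda>q. frechet_derivative ?T (at q) (local_rep Z c q)) has_derivative
        (\<lambda>h. frechet_derivative (local_rep Z d) (at (snd d m)) (transition_derivative c d m h))) (at ?p)"
      if Z: "differentiable_field_at A m Z" for Z
    proof (rule has_derivative_eventually_eq)
      have "?T ?p = snd d m" using c by (simp add: atlas.transition_chart charts_at_iff)
      then show "((\<lambda>q. local_rep Z d (?T q)) has_derivative
          (\<lambda>h. frechet_derivative (local_rep Z d) (at (snd d m)) (transition_derivative c d m h))) (at ?p)"
        using local_rep_has_derivative[OF Z d]
        by (intro has_derivative_compose[OF atlas.transition_has_derivative[OF c d]]) simp
      have "m \<in> fst d" "manifold_open A (fst d)" using d by (auto simp: charts_at_iff atlas.manifold_open_chart)
      from tangent_at_chart_inv[OF Z c] atlas.eventually_chart_inv_in[OF c this(2,1)]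
      show "\<forall>\<^sub>F q in nhds ?p. local_rep Z d (?T q) = frechet_derivative ?T (at q) (local_rep Z c q)"
      proof eventually_elim
        case (elim q)
        define n where "n = chart_inv c q"
        have n: "q = snd c n" "c \<in> charts_at A n" "d \<in> charts_at A n" "Z n \<in> tangent_space A n"
          using elim d by (auto simp: n_def charts_at_iff)
        then show ?case
          using atlas.tangent_space_transition[OF n(4,2,3)]
          by (simp add: local_rep_def atlas.transition_chart atlas.chart_inv_chart charts_at_iff)
      qed
    qed
    have tX: "transition_derivative c d m (X m c) = X m d" and tY: "transition_derivative c d m (Y m c) = Y m d"
      using atlas.tangent_space_transition[OF differentiable_field_at_tangent[OF X] c d]
        atlas.tangent_space_transition[OF differentiable_field_at_tangent[OF Y] c d] by simp_all
    show "lie_bracket A X Y m d = transition_derivative c d m (lie_bracket A X Y m c)"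
      using smooth_on_bracket[OF sm pS local_rep_has_derivative[OF X c] local_rep_has_derivative[OF Y c] push[OF X] push[OF Y]]
      by (simp add: lie_bracket_def c d local_rep_chart tX tY)
  qed
qed

lemma vector_field_on_chart_const:
  assumes c: "c \<in> A"
  shows "vector_field_on A (fst c) (\<lambda>q. tangent_of A c q e)"
  unfolding vector_field_on_def smooth_map_on_def
proof (intro conjI ballI)
  fix m assume m: "m \<in> fst c"
  then show "tangent_of A c m e \<in> tangent_space A m" using c by (simp add: atlas.tangent_of_in charts_at_iff)
  have "smooth_on (\<lambda>p. (p, 0) + (0, e)) (snd c ` fst c)"
    by (intro smooth_on_affine chart_open c bounded_linear_Pair bounded_linear_ident bounded_linear_zero)
  then have "smooth_on (map_rep c (tangent_chart A c) (\<lambda>m. (m, tangent_of A c m e))) (snd c ` fst c)"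
    by (rule smooth_on_cong)
       (use c in \<open>auto simp: snd_tangent_chart atlas.chart_inv_chart charts_at_iff\<close>)
  moreover have "(\<lambda>m. (m, tangent_of A c m e)) ` fst c \<subseteq> fst (tangent_chart A c)"
    using c by (auto simp: fst_tangent_chart atlas.tangent_of_in charts_at_iff)
  ultimately show "\<exists>ca\<in>A. \<exists>d\<in>tangent_bundle A. \<exists>W'. manifold_open A W' \<and> m \<in> W' \<and> W' \<subseteq> fst ca \<inter> fst c \<and>
     (\<lambda>m. (m, tangent_of A c m e)) ` W' \<subseteq> fst d \<and> smooth_on (map_rep ca d (\<lambda>m. (m, tangent_of A c m e))) (snd ca ` W')"
    using c m atlas.manifold_open_chart[OF c]
    by (intro bexI[of _ c] bexI[of _ "tangent_chart A c"] exI[of _ "fst c"]) (auto simp: tangent_bundle_def)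
qed

lemma vector_field_on_subset:
  assumes X: "vector_field_on A W X" and V: "manifold_open A V" "V \<subseteq> W"
  shows "vector_field_on A V X"
  unfolding vector_field_on_def smooth_map_on_def
proof (intro conjI ballI)
  fix m assume m: "m \<in> V"
  then show "X m \<in> tangent_space A m" using assms by (auto simp: vector_field_on_def)
  have sm: "smooth_map_on A (tangent_bundle A) W (\<lambda>m. (m, X m))" using X by (simp add: vector_field_on_def)
  have "m \<in> W" using m V by blast
  obtain c d W' where 1: "c \<in> A" "d \<in> tangent_bundle A" "manifold_open A W'" "m \<in> W'" "W' \<subseteq> fst c" "W' \<subseteq> W"
    "(\<lambda>m. (m, X m)) ` W' \<subseteq> fst d" "smooth_on (map_rep c d (\<lambda>m. (m, X m))) (snd c ` W')"
    using sm \<open>m \<in> W\<close> by (rule smooth_map_onE)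
  have op: "manifold_open A (W' \<inter> V)" using 1 V by (intro atlas.manifold_open_Int)
  have "smooth_on (map_rep c d (\<lambda>m. (m, X m))) (snd c ` (W' \<inter> V))"
    using 1(8) by (rule smooth_on_subset) (use 1 in \<open>auto intro!: atlas.manifold_open_image op\<close>)
  then show "\<exists>c\<in>A. \<exists>d\<in>tangent_bundle A. \<exists>W'. manifold_open A W' \<and> m \<in> W' \<and> W' \<subseteq> fst c \<inter> V \<and>
     (\<lambda>m. (m, X m)) ` W' \<subseteq> fst d \<and> smooth_on (map_rep c d (\<lambda>m. (m, X m))) (snd c ` W')"
    using 1 m op by (intro bexI[of _ c] bexI[of _ d] exI[of _ "W' \<inter> V"]) auto
qed

lemma vector_field_on_minus:
  assumes X: "vector_field_on A W X"
  shows "vector_field_on A W (\<lambda>m. - X m)"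
  unfolding vector_field_on_def smooth_map_on_def
proof (intro conjI ballI)
  fix m assume m: "m \<in> W"
  have Xt: "X m \<in> tangent_space A m" if "m \<in> W" for m using assms that by (auto simp: vector_field_on_def)
  then show "- X m \<in> tangent_space A m" using m by (simp add: atlas.tangent_space_minus)
  have sm: "smooth_map_on A (tangent_bundle A) W (\<lambda>m. (m, X m))" using X by (simp add: vector_field_on_def)
  obtain c d W' where 1: "c \<in> A" "d \<in> tangent_bundle A" "manifold_open A W'" "m \<in> W'" "W' \<subseteq> fst c" "W' \<subseteq> W"
    "(\<lambda>m. (m, X m)) ` W' \<subseteq> fst d" "smooth_on (map_rep c d (\<lambda>m. (m, X m))) (snd c ` W')"
    using sm m by (rule smooth_map_onE)
  obtain d' where d': "d' \<in> A" "d = tangent_chart A d'" using 1(2) unfolding tangent_bundle_def by blast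
  have "smooth_on (\<lambda>p. (\<lambda>x. (fst x, - snd x)) (map_rep c d (\<lambda>m. (m, X m)) p)) (snd c ` W')"
    by (rule smooth_on_bounded_linear_compose[OF _ 1(8)])
       (intro bounded_linear_Pair bounded_linear_minus bounded_linear_fst bounded_linear_snd)
  then have "smooth_on (map_rep c d (\<lambda>m. (m, - X m))) (snd c ` W')"
    by (rule smooth_on_cong) (simp add: d' snd_tangent_chart)
  moreover have "(\<lambda>m. (m, - X m)) ` W' \<subseteq> fst d"
    using 1(7) by (auto simp: d' fst_tangent_chart atlas.tangent_space_minus)
  ultimately show "\<exists>c\<in>A. \<exists>d\<in>tangent_bundle A. \<exists>W'. manifold_open A W' \<and> m \<in> W' \<and> W' \<subseteq> fst c \<inter> W \<and>
     (\<lambda>m. (m, - X m)) ` W' \<subseteq> fst d \<and> smooth_on (map_rep c d (\<lambda>m. (m, - X m))) (snd c ` W')"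
    using 1 by (intro bexI[of _ c] bexI[of _ d] exI[of _ W']) auto
qed

lemma lie_bracket_minus:
  assumes X: "differentiable_field_at A m X" and Y: "differentiable_field_at A m Y"
  shows "lie_bracket A (\<lambda>q. - X q) Y m = - lie_bracket A X Y m"
    and "lie_bracket A X (\<lambda>q. - Y q) m = - lie_bracket A X Y m"
proof -
  have 1: "frechet_derivative (local_rep (\<lambda>q. - Z q) c) (at (snd c m)) = (\<lambda>h. - frechet_derivative (local_rep Z c) (at (snd c m)) h)"
    if Z: "differentiable_field_at A m Z" and c: "c \<in> charts_at A m" for Z c
  proof -
    have "((\<lambda>q. - local_rep Z c q) has_derivative (\<lambda>h. - frechet_derivative (local_rep Z c) (at (snd c m)) h)) (at (snd c m))"
      by (intro has_derivative_minus local_rep_has_derivative Z c)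
    then show ?thesis using frechet_derivative_at by (fastforce simp: local_rep_def)
  qed
  have lin: "linear (frechet_derivative (local_rep Z c) (at (snd c m)))"
    if Z: "differentiable_field_at A m Z" and c: "c \<in> charts_at A m" for Z c
    using local_rep_has_derivative[OF Z c] by (rule has_derivative_linear)
  show "lie_bracket A (\<lambda>q. - X q) Y m = - lie_bracket A X Y m"
    by (rule ext) (simp add: lie_bracket_def 1[OF X] linear_neg[OF lin[OF Y]])
  show "lie_bracket A X (\<lambda>q. - Y q) m = - lie_bracket A X Y m"
    by (rule ext) (simp add: lie_bracket_def 1[OF Y] linear_neg[OF lin[OF X]])
qed

end

section \<open>Operators in charts and the torsion tensor\<close>

text \<open>
  \<open>N\<close> in the chart \<open>c\<close>, as a function \<open>(p, e) \<mapsto> N\<^sub>p e\<close> of two variables: the smoothness of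
  \<open>N\<close> concerns the map of total spaces, not a map into a space of bounded operators.
\<close>
definition operator_rep ::
  "('m, 'e::real_normed_vector) atlas \<Rightarrow> ('m \<Rightarrow> ('m, 'e) tvec \<Rightarrow> ('m, 'e) tvec) \<Rightarrow>
     ('m, 'e) chart \<Rightarrow> 'e \<times> 'e \<Rightarrow> 'e" where
  "operator_rep A N c = (\<lambda>(p, e). N (chart_inv c p) (tangent_of A c (chart_inv c p) e) c)"

text \<open>
  The torsion of \<open>N\<close> for fields that are constant in the chart \<open>c\<close>: \<open>J\<close> is \<open>N\<close> at \<open>m\<close>, and \<open>G v h\<close> is the
  derivative of \<open>p \<mapsto> N\<^sub>p v\<close> in direction \<open>h\<close>.
\<close>
definition torsion_form ::
  "('m, 'e::real_normed_vector) atlas \<Rightarrow> ('m \<Rightarrow> ('m, 'e) tvec \<Rightarrow> ('m, 'e) tvec) \<Rightarrow>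
     ('m, 'e) chart \<Rightarrow> 'm \<Rightarrow> 'e \<Rightarrow> 'e \<Rightarrow> 'e" where
  "torsion_form A N c m v w =
     (let n = operator_rep A N c; p = snd c m;
          J = (\<lambda>w. n (p, w)); G = (\<lambda>v h. frechet_derivative n (at (p, v)) (h, 0))
      in G v (J w) - G w (J v) - J (G v w - G w v))"

lemma
  assumes "N_operator A N"
  shows N_operator_tangent: "m \<in> carrier A \<Longrightarrow> v \<in> tangent_space A m \<Longrightarrow> N m v \<in> tangent_space A m"
    and N_operator_chart: "m \<in> carrier A \<Longrightarrow> c \<in> charts_at A m \<Longrightarrow>
      \<exists>L. bounded_linear L \<and> (\<forall>v\<in>tangent_space A m. N m v c = L (v c))"
    and N_operator_smooth: "smooth_map_on (tangent_bundle A) (tangent_bundle A) (carrier (tangent_bundle A))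
       (\<lambda>(m, v). (m, N m v))"
  using assms[unfolded N_operator_def] by blast+

context banach_manifold
begin

context
  fixes N assumes N: "N_operator A N"
begin

lemma operator_rep_chart:
  assumes "c \<in> charts_at A m" "v \<in> tangent_space A m"
  shows "operator_rep A N c (snd c m, v c) = N m v c"
  using assms by (simp add: operator_rep_def atlas.chart_inv_chart atlas.tangent_of_eq charts_at_iff)

lemma bounded_linear_operator_rep:
  assumes c: "c \<in> charts_at A m"
  shows "bounded_linear (\<lambda>e. operator_rep A N c (snd c m, e))"
proof -
  obtain L where L: "bounded_linear L" "\<forall>v\<in>tangent_space A m. N m v c = L (v c)"
    using N_operator_chart[OF N charts_at_imp_carrier[OF c] c] by blast
  have "operator_rep A N c (snd c m, e) = L e" for e
    using operator_rep_chart[OF c atlas.tangent_of_in[OF c, of e]] L(2) atlas.tangent_of_in[OF c, of e]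
    by (simp add: c)
  then show ?thesis using L(1) by simp
qed

lemma operator_rep_differentiable:
  assumes c: "c \<in> charts_at A m"
  shows "operator_rep A N c differentiable (at (snd c m, e))"
proof -
  define v where "v = tangent_of A c m e"
  have v: "v \<in> tangent_space A m" "v c = e" using c by (simp_all add: v_def atlas.tangent_of_in)
  have m: "m \<in> carrier A" using c by (rule charts_at_imp_carrier)
  let ?C = "tangent_chart A c" let ?f = "\<lambda>(m, v). (m, N m v)"
  have C: "?C \<in> charts_at (tangent_bundle A) (m, v)" "?C \<in> charts_at (tangent_bundle A) (?f (m, v))"
    using c v m N_operator_tangent[OF N m v(1)] by (auto intro: charts_at_tangent_bundle)
  have "(m, v) \<in> carrier (tangent_bundle A)" using m v by (simp add: carrier_tangent_bundle)
  then have "map_rep ?C ?C ?f differentiable (at (snd ?C (m, v)))"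
    by (rule smooth_map_rep_differentiable[OF tangent_bundle_atlas tangent_bundle_atlas N_operator_smooth[OF N] _ C])
  then have "(snd \<circ> map_rep ?C ?C ?f) differentiable (at (snd c m, e))"
    by (intro differentiable_chain_at) (auto simp: snd_tangent_chart v intro: bounded_linear_imp_differentiable bounded_linear_snd)
  then obtain L where L: "((snd \<circ> map_rep ?C ?C ?f) has_derivative L) (at (snd c m, e))"
    by (auto simp: differentiable_def)
  have "(operator_rep A N c has_derivative L) (at (snd c m, e))"
  proof (rule has_derivative_transform_within_open[OF L])
    show "open (snd c ` fst c \<times> (UNIV :: 'e set))"
      using c chart_open by (intro open_Times) (auto simp: charts_at_iff)
    show "(snd c m, e) \<in> snd c ` fst c \<times> UNIV" using c by (auto simp: charts_at_iff)
    fix x assume "x \<in> snd c ` fst c \<times> (UNIV :: 'e set)"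
    then obtain p e where x: "x = (p, e)" "p \<in> snd c ` fst c" by auto
    have "c \<in> A" using c by (simp add: charts_at_iff)
    then show "(snd \<circ> map_rep ?C ?C ?f) x = operator_rep A N c x"
      by (simp add: x(1) operator_rep_def atlas.chart_inv_tangent_chart[OF _ x(2)] snd_tangent_chart)
  qed
  then show ?thesis by (rule differentiableI)
qed

text \<open>
  The product rule for \<open>N\<^bsub>\<psi> q\<^esub> (x q)\<close>. Linearity in the fibres identifies the partial derivative in the
  second variable with \<open>N\<close> itself. The map \<open>\<psi>\<close> is general since the rule is also applied along \<open>\<tau>\<close>.
\<close>
lemma operator_rep_compose_has_derivative:
  assumes c: "c \<in> charts_at A m"
    and \<psi>: "(\<psi> has_derivative \<psi>') (at q)" "\<psi> q = snd c m" and x: "(x has_derivative x') (at q)"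
  shows "((\<lambda>q. operator_rep A N c (\<psi> q, x q)) has_derivative
    (\<lambda>h. frechet_derivative (operator_rep A N c) (at (snd c m, x q)) (\<psi>' h, 0) + operator_rep A N c (snd c m, x' h))) (at q)"
proof -
  let ?n = "operator_rep A N c" let ?D = "frechet_derivative ?n (at (snd c m, x q))"
  have D: "(?n has_derivative ?D) (at (snd c m, x q))"
    using operator_rep_differentiable[OF c] by (simp add: frechet_derivative_works)
  interpret D: bounded_linear ?D using D by (rule has_derivative_bounded_linear)
  have "((\<lambda>e. ?n (snd c m, e)) has_derivative (\<lambda>w. ?D (0, w))) (at (x q))"
    by (rule has_derivative_compose[OF has_derivative_Pair[OF has_derivative_const has_derivative_ident] D])
  then have fib: "?D (0, w) = ?n (snd c m, w)" for w
    using has_derivative_unique bounded_linear_imp_has_derivative[OF bounded_linear_operator_rep[OF c]] by metis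
  have split: "?D (h, w) = ?D (h, 0) + ?n (snd c m, w)" for h w
    using D.add[of "(h, 0)" "(0, w)"] by (simp add: fib)
  have "((\<lambda>q. ?n (\<psi> q, x q)) has_derivative (\<lambda>h. ?D (\<psi>' h, x' h))) (at q)"
    using has_derivative_compose[OF has_derivative_Pair[OF \<psi>(1) x]] D \<psi>(2) by simp
  then show ?thesis by (subst (asm) split)
qed

lemma local_rep_operator_has_derivative:
  assumes X: "differentiable_field_at A m X" and c: "c \<in> charts_at A m"
  shows "(local_rep (\<lambda>q. N q (X q)) c has_derivative
    (\<lambda>h. frechet_derivative (operator_rep A N c) (at (snd c m, X m c)) (h, 0)
       + operator_rep A N c (snd c m, frechet_derivative (local_rep X c) (at (snd c m)) h))) (at (snd c m))"
proof (rule has_derivative_eventually_eq)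
  show "((\<lambda>p. operator_rep A N c (p, local_rep X c p)) has_derivative
    (\<lambda>h. frechet_derivative (operator_rep A N c) (at (snd c m, X m c)) (h, 0)
       + operator_rep A N c (snd c m, frechet_derivative (local_rep X c) (at (snd c m)) h))) (at (snd c m))"
    using operator_rep_compose_has_derivative[OF c has_derivative_ident refl local_rep_has_derivative[OF X c]]
    by (simp add: local_rep_chart[OF c])
  show "\<forall>\<^sub>F p in nhds (snd c m). operator_rep A N c (p, local_rep X c p) = local_rep (\<lambda>q. N q (X q)) c p"
    using tangent_at_chart_inv[OF X c]
  proof eventually_elim
    case (elim p)
    then show ?case using operator_rep_chart[of c "chart_inv c p" "X (chart_inv c p)"] by (simp add: local_rep_def)
  qed
qed

lemma differentiable_field_at_operator:
  assumes X: "differentiable_field_at A m X"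
  shows "differentiable_field_at A m (\<lambda>q. N q (X q))"
  unfolding differentiable_field_at_def
proof (intro conjI ballI)
  obtain W where W: "manifold_open A W" "m \<in> W" "\<forall>q\<in>W. X q \<in> tangent_space A q"
    using X unfolding differentiable_field_at_def by blast
  have "\<forall>q\<in>W. N q (X q) \<in> tangent_space A q"
    using W N_operator_tangent[OF N manifold_open_carrier[OF W(1)]] by blast
  then show "\<exists>W. manifold_open A W \<and> m \<in> W \<and> (\<forall>q\<in>W. N q (X q) \<in> tangent_space A q)"
    using W by blast
  show "local_rep (\<lambda>q. N q (X q)) c differentiable (at (snd c m))" if "c \<in> charts_at A m" for c
    using local_rep_operator_has_derivative[OF X that] by (rule differentiableI)
qed

lemma torsion_tangent:
  assumes m: "m \<in> carrier A" and X: "differentiable_field_at A m X" and Y: "differentiable_field_at A m Y"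
  shows "torsion A N X Y m \<in> tangent_space A m"
  unfolding torsion_def Let_def
  by (intro atlas.tangent_space_diff atlas.tangent_space_add N_operator_tangent[OF N m] lie_bracket_tangent m
      differentiable_field_at_operator X Y)

text \<open>
  Tensoriality: after inserting the product rule in the brackets, the derivatives of the fields \<open>X\<close> and
  \<open>Y\<close> cancel.
\<close>
lemma torsion_chart:
  assumes c: "c \<in> charts_at A m" and X: "differentiable_field_at A m X" and Y: "differentiable_field_at A m Y"
  shows "torsion A N X Y m c = torsion_form A N c m (X m c) (Y m c)"
proof -
  have m: "m \<in> carrier A" using c by (rule charts_at_imp_carrier)
  let ?J = "\<lambda>e. operator_rep A N c (snd c m, e)"
  let ?G = "\<lambda>v h. frechet_derivative (operator_rep A N c) (at (snd c m, v)) (h, 0)"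
  interpret J: bounded_linear ?J by (rule bounded_linear_operator_rep[OF c])
  have NZ: "N m Z c = ?J (Z c)" if "Z \<in> tangent_space A m" for Z
    using operator_rep_chart[OF c that] by simp
  note NX = differentiable_field_at_operator[OF X] and NY = differentiable_field_at_operator[OF Y]
  note br = lie_bracket_tangent[OF m]
  have XY: "X m \<in> tangent_space A m" "Y m \<in> tangent_space A m" using X Y differentiable_field_at_tangent by auto
  have d: "frechet_derivative (local_rep (\<lambda>q. N q (Z q)) c) (at (snd c m)) =
     (\<lambda>h. ?G (Z m c) h + ?J (frechet_derivative (local_rep Z c) (at (snd c m)) h))" if "differentiable_field_at A m Z" for Z
    using frechet_derivative_at[OF local_rep_operator_has_derivative[OF that c]] by simp
  have in1: "lie_bracket A (\<lambda>q. N q (X q)) Y m + lie_bracket A X (\<lambda>q. N q (Y q)) m - N m (lie_bracket A X Y m) \<in> tangent_space A m"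
    by (intro atlas.tangent_space_diff atlas.tangent_space_add N_operator_tangent[OF N m] br X Y NX NY)
  have lin: "linear (frechet_derivative (local_rep Z c) (at (snd c m)))"
    if Z: "differentiable_field_at A m Z" for Z
    using local_rep_has_derivative[OF Z c] by (rule has_derivative_linear)
  show ?thesis
    unfolding torsion_def torsion_form_def Let_def
    by (simp add: NZ[OF in1] NZ[OF br[OF X Y]])
       (simp add: lie_bracket_def c d X Y NZ[OF XY(1)] NZ[OF XY(2)] J.add J.diff)
qed

lemma nijenhuis_operator_imp_torsion_form:
  assumes ni: "nijenhuis_operator A N" and c: "c \<in> charts_at A m"
  shows "torsion_form A N c m v w = 0"
proof -
  let ?X = "\<lambda>q. tangent_of A c q v" and ?Y = "\<lambda>q. tangent_of A c q w"
  have cA: "c \<in> A" "m \<in> fst c" using c by (auto simp: charts_at_iff)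
  note f = vector_field_on_chart_const[OF cA(1)] atlas.manifold_open_chart[OF cA(1)]
  have "torsion A N ?X ?Y m = 0"
    using ni f cA(2) unfolding nijenhuis_operator_def by blast
  moreover have "torsion A N ?X ?Y m c = torsion_form A N c m (?X m c) (?Y m c)"
    by (intro torsion_chart c vector_field_on_imp_differentiable_field_at[OF f(2) cA(2) f(1)])
  ultimately show ?thesis using c by simp
qed

lemma nijenhuis_operatorI:
  assumes "\<And>m. m \<in> carrier A \<Longrightarrow> \<exists>c\<in>charts_at A m. \<forall>v w. torsion_form A N c m v w = 0"
  shows "nijenhuis_operator A N"
  unfolding nijenhuis_operator_def
proof (intro conjI N allI impI ballI)
  fix W X Y m assume W: "manifold_open A W" and XY: "vector_field_on A W X" "vector_field_on A W Y" and m: "m \<in> W"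
  have mc: "m \<in> carrier A" using W m by (rule manifold_open_carrier)
  obtain c where c: "c \<in> charts_at A m" "\<forall>v w. torsion_form A N c m v w = 0" using assms[OF mc] by blast
  note f = vector_field_on_imp_differentiable_field_at[OF W m XY(1)] vector_field_on_imp_differentiable_field_at[OF W m XY(2)]
  have "torsion A N X Y m c = (0 :: ('m, 'e) tvec) c"
    using torsion_chart[OF c(1) f] c(2) by simp
  with torsion_tangent[OF mc f] atlas.tangent_space_zero c(1)
  show "torsion A N X Y m = 0" by (rule atlas.tangent_eqI)
qed

text \<open>
  Smoothness of \<open>N\<close> at \<open>(m, v)\<close> is witnessed in a chart that depends on \<open>v\<close>. Extending \<open>v\<close> constantly in that very
  chart represents \<open>NX\<close> as the restriction of the smooth representation of \<open>N\<close> to an affine slice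
  \<open>p \<mapsto> (p, e)\<close>, so \<open>NX\<close> is smooth.
\<close>
lemma ex_vector_field_with_smooth_image:
  assumes m: "m \<in> carrier A" and v: "v \<in> tangent_space A m"
  shows "\<exists>W X. manifold_open A W \<and> m \<in> W \<and> vector_field_on A W X \<and> vector_field_on A W (\<lambda>q. N q (X q)) \<and> X m = v"
proof -
  let ?f = "\<lambda>(m, v). (m, N m v)"
  have "(m, v) \<in> carrier (tangent_bundle A)" using m v by (simp add: carrier_tangent_bundle)
  with N_operator_smooth[OF N] obtain C D V where 1: "C \<in> tangent_bundle A" "D \<in> tangent_bundle A"
    "manifold_open (tangent_bundle A) V" "(m, v) \<in> V" "V \<subseteq> fst C" "V \<subseteq> carrier (tangent_bundle A)"
    "?f ` V \<subseteq> fst D" "smooth_on (map_rep C D ?f) (snd C ` V)"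
    by (rule smooth_map_onE)
  obtain c d where c: "c \<in> A" "C = tangent_chart A c" and d: "d \<in> A" "D = tangent_chart A d"
    using 1(1,2) unfolding tangent_bundle_def by blast
  have mc: "m \<in> fst c" using 1(4,5) by (auto simp: c fst_tangent_chart)
  define e where "e = v c"
  define X where "X q = tangent_of A c q e" for q
  have Xm: "X m = v" using c(1) mc v by (simp add: X_def e_def atlas.tangent_of_eq charts_at_iff)
  define W where "W = {q \<in> fst c. (q, X q) \<in> V}"
  have oV: "open (snd C ` V)" using smooth_on_imp_open[OF 1(8)] .
  have rep: "snd C (q, X q) = (snd c q, e)" if "q \<in> fst c" for q
    using that c(1) by (simp add: c snd_tangent_chart X_def charts_at_iff)
  have inC: "(q, X q) \<in> fst C" if "q \<in> fst c" for q
    using that c(1) by (simp add: c fst_tangent_chart X_def atlas.tangent_of_in charts_at_iff)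
  have injC: "inj_on (snd C) (fst C)" using atlas.inj_on_tangent_chart[OF c(1)] by (simp add: c)
  have imW: "snd c ` W = snd c ` fst c \<inter> (\<lambda>p. (p, e)) -` (snd C ` V)"
  proof (intro equalityI subsetI)
    fix p assume "p \<in> snd c ` W"
    then show "p \<in> snd c ` fst c \<inter> (\<lambda>p. (p, e)) -` (snd C ` V)"
      using rep by (force simp: W_def)
  next
    fix p assume "p \<in> snd c ` fst c \<inter> (\<lambda>p. (p, e)) -` (snd C ` V)"
    then obtain q x where q: "p = snd c q" "q \<in> fst c" "x \<in> V" "snd C (q, X q) = snd C x"
      using rep by auto
    then have "(q, X q) = x" using injC inC 1(5) by (auto dest: inj_onD)
    then show "p \<in> snd c ` W" using q by (auto simp: W_def)
  qed
  have "continuous_on (snd c ` fst c) (\<lambda>p. (p, e))" by (intro continuous_intros)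
  then have oW: "open (snd c ` W)" unfolding imW by (rule continuous_open_preimage[OF _ chart_open[OF c(1)] oV])
  have Wc: "W \<subseteq> fst c" by (auto simp: W_def)
  have W: "manifold_open A W" by (rule atlas.manifold_openI[OF c(1) Wc oW])
  have mW: "m \<in> W" using mc 1(4) Xm by (simp add: W_def)
  have fX: "vector_field_on A W X"
    unfolding X_def using vector_field_on_chart_const[OF c(1)] W Wc by (rule vector_field_on_subset)
  have fNX: "vector_field_on A W (\<lambda>q. N q (X q))"
    unfolding vector_field_on_def smooth_map_on_def
  proof (intro conjI ballI)
    fix q assume q: "q \<in> W"
    have "X q \<in> tangent_space A q" using fX q by (auto simp: vector_field_on_def)
    then show "N q (X q) \<in> tangent_space A q"
      by (intro N_operator_tangent[OF N] manifold_open_carrier[OF W q])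
    have "smooth_on (\<lambda>p. map_rep C D ?f ((p, 0) + (0, e))) (snd c ` W)"
      by (rule smooth_on_compose_affine[OF _ 1(8) oW])
         (use imW in \<open>auto intro: bounded_linear_Pair bounded_linear_ident bounded_linear_zero\<close>)
    then have sm: "smooth_on (map_rep c D (\<lambda>m. (m, N m (X m)))) (snd c ` W)"
    proof (rule smooth_on_cong)
      fix p assume "p \<in> snd c ` W"
      then have p: "p \<in> snd c ` fst c" using Wc by auto
      show "map_rep C D ?f ((p, 0) + (0, e)) = map_rep c D (\<lambda>m. (m, N m (X m))) p"
        by (simp add: c atlas.chart_inv_tangent_chart[OF c(1) p] X_def)
    qed
    have "(\<lambda>m. (m, N m (X m))) ` W \<subseteq> fst D"
      using 1(7) by (auto simp: W_def)
    with sm show "\<exists>c\<in>A. \<exists>d\<in>tangent_bundle A. \<exists>W'. manifold_open A W' \<and> q \<in> W' \<and> W' \<subseteq> fst c \<inter> W \<and>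
       (\<lambda>m. (m, N m (X m))) ` W' \<subseteq> fst d \<and> smooth_on (map_rep c d (\<lambda>m. (m, N m (X m)))) (snd c ` W')"
      using c(1) 1(2) W q Wc
      by (intro bexI[of _ c] bexI[of _ D] exI[of _ W] conjI) auto
  qed
  show ?thesis using W mW fX fNX Xm by blast
qed

end

end

section \<open>Projectable operators and involutivity\<close>

text \<open>
  Conjugation \<open>X + iY \<mapsto> X - iY\<close> commutes with the bracket, because that is complex bilinear and real on
  real fields.
\<close>
lemma (in banach_manifold) involutive_conjugate:
  assumes Z: "involutive A Z" and conj: "\<And>m x y. m \<in> carrier A \<Longrightarrow> (x, y) \<in> Z' m \<longleftrightarrow> (x, - y) \<in> Z m"
  shows "involutive A Z'"
  unfolding involutive_def
proof (intro allI impI ballI)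
  fix W P Q m
  assume W: "manifold_open A W" and P: "complex_vector_field_on A W P" and Q: "complex_vector_field_on A W Q"
    and PZ: "\<forall>m\<in>W. P m \<in> Z' m" and QZ: "\<forall>m\<in>W. Q m \<in> Z' m" and m: "m \<in> W"
  let ?b = "\<lambda>P m. (fst (P m), - snd (P m))"
  have conjW: "?b P q \<in> Z q" if "P q \<in> Z' q" "q \<in> W" for P q
    using conj[OF manifold_open_carrier[OF W that(2)], of "fst (P q)" "snd (P q)"] that(1) by simp
  have cv: "complex_vector_field_on A W (?b P)" if "complex_vector_field_on A W P" for P
    using that by (simp add: complex_vector_field_on_def vector_field_on_minus)
  have "complex_lie_bracket A (?b P) (?b Q) m \<in> Z m"
    using Z[unfolded involutive_def, rule_format, OF W cv[OF P] cv[OF Q]] conjW PZ QZ m by blast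
  moreover have "complex_lie_bracket A (?b P) (?b Q) m = ?b (complex_lie_bracket A P Q) m"
  proof -
    have d: "differentiable_field_at A m (\<lambda>q. fst (P q))" "differentiable_field_at A m (\<lambda>q. snd (P q))"
      "differentiable_field_at A m (\<lambda>q. fst (Q q))" "differentiable_field_at A m (\<lambda>q. snd (Q q))"
      "differentiable_field_at A m (\<lambda>q. - snd (Q q))"
      using P Q vector_field_on_minus unfolding complex_vector_field_on_def
      by (blast intro: vector_field_on_imp_differentiable_field_at[OF W m])+
    show ?thesis using d by (simp add: complex_lie_bracket_def Let_def lie_bracket_minus)
  qed
  ultimately show "complex_lie_bracket A P Q m \<in> Z' m"
    using conj[OF manifold_open_carrier[OF W m], of "fst (complex_lie_bracket A P Q m)" "snd (complex_lie_bracket A P Q m)"]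
    by simp
qed

locale projected_operator = M: banach_manifold A + M\<^sub>0: banach_manifold A\<^sub>0
  for A :: "('m, 'e::banach) atlas" and A\<^sub>0 :: "('k, 'f::banach) atlas" +
  fixes \<tau> :: "'m \<Rightarrow> 'k"
    and N :: "'m \<Rightarrow> ('m, 'e) tvec \<Rightarrow> ('m, 'e) tvec"
    and N\<^sub>0 :: "'k \<Rightarrow> ('k, 'f) tvec \<Rightarrow> ('k, 'f) tvec"
  assumes fib: "fibration A A\<^sub>0 \<tau>" and N: "N_operator A N" and N\<^sub>0: "N_operator A\<^sub>0 N\<^sub>0"
    and proj: "projects_to A A\<^sub>0 \<tau> N N\<^sub>0"
begin

abbreviation T where "T \<equiv> tangent_map A A\<^sub>0 \<tau>"

lemma \<tau>_smooth: "smooth_map_on A A\<^sub>0 (carrier A) \<tau>"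
  and \<tau>_onto: "\<tau> ` carrier A = carrier A\<^sub>0"
  and T_onto: "m \<in> carrier A \<Longrightarrow> T m ` tangent_space A m = tangent_space A\<^sub>0 (\<tau> m)"
  using fib unfolding fibration_def by blast+

lemma T_N: "m \<in> carrier A \<Longrightarrow> v \<in> tangent_space A m \<Longrightarrow> T m (N m v) = N\<^sub>0 (\<tau> m) (T m v)"
  using proj unfolding projects_to_def by simp

lemma T_in: "m \<in> carrier A \<Longrightarrow> v \<in> tangent_space A m \<Longrightarrow> T m v \<in> tangent_space A\<^sub>0 (\<tau> m)"
  using T_onto by blast

lemma rep_has_derivative:
  assumes c: "c \<in> charts_at A m" and d: "d \<in> charts_at A\<^sub>0 (\<tau> m)"
  shows "(map_rep c d \<tau> has_derivative frechet_derivative (map_rep c d \<tau>) (at (snd c m))) (at (snd c m))"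
proof -
  have "map_rep c d \<tau> differentiable (at (snd c m))"
    by (rule smooth_map_rep_differentiable[OF _ _ \<tau>_smooth charts_at_imp_carrier[OF c] c d]) unfold_locales
  then show ?thesis by (simp add: frechet_derivative_works)
qed

text \<open>
  \<open>tangent_map\<close> uses one chosen chart at \<open>m\<close>; by the chain rule any other chart gives the same vector.
\<close>
lemma T_chart:
  assumes c: "c \<in> charts_at A m" and d: "d \<in> charts_at A\<^sub>0 (\<tau> m)" and v: "v \<in> tangent_space A m"
  shows "T m v d = frechet_derivative (map_rep c d \<tau>) (at (snd c m)) (v c)"
proof -
  define c' where "c' = (SOME c. c \<in> charts_at A m)"
  have c': "c' \<in> charts_at A m" unfolding c'_def using c by (rule someI)
  have "(map_rep c' d \<tau> has_derivative frechet_derivative (map_rep c' d \<tau>) (at (snd c' m))) (at (transition c c' (snd c m)))"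
    using rep_has_derivative[OF c' d] c by (simp add: M.atlas.transition_chart charts_at_iff)
  from diff_chain_at[OF M.atlas.transition_has_derivative[OF c c'] this]
  have "((map_rep c' d \<tau> \<circ> transition c c') has_derivative
     (frechet_derivative (map_rep c' d \<tau>) (at (snd c' m)) \<circ> transition_derivative c c' m)) (at (snd c m))" .
  moreover have "\<forall>\<^sub>F p in nhds (snd c m). (map_rep c' d \<tau> \<circ> transition c c') p = map_rep c d \<tau> p"
    using M.atlas.eventually_chart_inv_in[OF c M.atlas.manifold_open_chart[of c']] c'
    by (auto elim!: eventually_mono simp: charts_at_iff transition_def M.atlas.chart_inv_chart)
  ultimately have "(map_rep c d \<tau> has_derivative
     (frechet_derivative (map_rep c' d \<tau>) (at (snd c' m)) \<circ> transition_derivative c c' m)) (at (snd c m))"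
    by (rule has_derivative_eventually_eq)
  from frechet_derivative_at[OF this]
  have "frechet_derivative (map_rep c d \<tau>) (at (snd c m)) (v c) = frechet_derivative (map_rep c' d \<tau>) (at (snd c' m)) (v c')"
    using M.atlas.tangent_space_transition[OF v c c'] by (metis o_apply)
  then show ?thesis using d by (simp add: tangent_map_def Let_def c'_def)
qed

lemma
  assumes m: "m \<in> carrier A" and v: "v \<in> tangent_space A m" and w: "w \<in> tangent_space A m"
  shows T_add: "T m (v + w) = T m v + T m w" and T_diff: "T m (v - w) = T m v - T m w"
proof -
  obtain c where c: "c \<in> charts_at A m" using charts_at_ex[OF m] by blast
  have off: "T m v d = 0" if "d \<notin> charts_at A\<^sub>0 (\<tau> m)" for d v
    using that by (simp add: tangent_map_def Let_def)
  have lin: "linear (frechet_derivative (map_rep c d \<tau>) (at (snd c m)))" if "d \<in> charts_at A\<^sub>0 (\<tau> m)" for d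
    using rep_has_derivative[OF c that] by (rule has_derivative_linear)
  show "T m (v + w) = T m v + T m w"
  proof
    fix d show "T m (v + w) d = (T m v + T m w) d"
      by (cases "d \<in> charts_at A\<^sub>0 (\<tau> m)")
        (simp_all add: T_chart[OF c] v w M.atlas.tangent_space_add linear_add[OF lin] off)
  qed
  show "T m (v - w) = T m v - T m w"
  proof
    fix d show "T m (v - w) d = (T m v - T m w) d"
      by (cases "d \<in> charts_at A\<^sub>0 (\<tau> m)")
        (simp_all add: T_chart[OF c] v w M.atlas.tangent_space_diff linear_diff[OF lin] off)
  qed
qed

lemma Zhat_plus_iff:
  assumes m: "m \<in> carrier A"
  shows "(x, y) \<in> Zhat_plus A A\<^sub>0 \<tau> N m \<longleftrightarrow>
    x \<in> tangent_space A m \<and> y \<in> tangent_space A m \<and> T m y = N\<^sub>0 (\<tau> m) (T m x)"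
  using N_operator_tangent[OF N m, of x] M.atlas.tangent_space_diff[of y m "N m x"]
  by (auto simp: Zhat_plus_def vertical_def T_diff[OF m] T_N[OF m])

lemma Zhat_minus_iff:
  assumes m: "m \<in> carrier A"
  shows "(x, y) \<in> Zhat_minus A A\<^sub>0 \<tau> N m \<longleftrightarrow> (x, - y) \<in> Zhat_plus A A\<^sub>0 \<tau> N m"
proof -
  have neg: "- v \<in> vertical A A\<^sub>0 \<tau> m" if "v \<in> vertical A A\<^sub>0 \<tau> m" for v
    using that M.atlas.tangent_space_minus[of v m] T_diff[OF m M.atlas.tangent_space_zero, of v]
      T_diff[OF m M.atlas.tangent_space_zero M.atlas.tangent_space_zero]
    by (simp add: vertical_def)
  have "- y - N m x \<in> vertical A A\<^sub>0 \<tau> m \<longleftrightarrow> y + N m x \<in> vertical A A\<^sub>0 \<tau> m"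
    using neg[of "- y - N m x"] neg[of "y + N m x"] by (auto simp: algebra_simps)
  moreover have "- y \<in> tangent_space A m \<longleftrightarrow> y \<in> tangent_space A m"
    using M.atlas.tangent_space_minus[of y m] M.atlas.tangent_space_minus[of "- y" m] by auto
  ultimately show ?thesis by (simp add: Zhat_plus_def Zhat_minus_def)
qed

text \<open>
  In charts let \<open>J\<close> be \<open>N\<^sub>0\<close> at \<open>\<tau> m\<close> and \<open>G v h\<close> the derivative there of \<open>p \<mapsto> (N\<^sub>0)\<^sub>p v\<close> in direction \<open>h\<close>.
  With \<open>x = T X\<close> and \<open>y = T Y = N\<^sub>0 x\<close> the product rule reads \<open>Dy (h) = G x (T h) + J (Dx (h))\<close>, likewise for
  the second section. Inserting this in
  \<open>T r = Dx (X') - Dx' (X) - Dy (Y') + Dy' (Y)\<close> and \<open>T i = Dx (Y') - Dy' (X) + Dy (X') - Dx' (Y)\<close>,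
  every term with \<open>Dx\<close> or \<open>Dx'\<close> cancels in \<open>T i - J (T r)\<close> by \<open>J\<^sup>2 = -1\<close>, and the terms with \<open>G\<close> are \<open>J\<close> applied
  to the torsion.
\<close>
lemma complex_bracket_defect:
  assumes sm: "c \<in> A" "d \<in> A\<^sub>0" "manifold_open A V" "m \<in> V" "V \<subseteq> fst c" "\<tau> ` V \<subseteq> fst d"
      "smooth_on (map_rep c d \<tau>) (snd c ` V)"
    and W: "manifold_open A W" "m \<in> W"
    and P: "complex_vector_field_on A W P" "\<And>q. q \<in> W \<Longrightarrow> P q \<in> Zhat_plus A A\<^sub>0 \<tau> N q"
    and Q: "complex_vector_field_on A W Q" "\<And>q. q \<in> W \<Longrightarrow> Q q \<in> Zhat_plus A A\<^sub>0 \<tau> N q"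
    and J2: "\<And>v. v \<in> tangent_space A\<^sub>0 (\<tau> m) \<Longrightarrow> N\<^sub>0 (\<tau> m) (N\<^sub>0 (\<tau> m) v) = - v"
    and b: "complex_lie_bracket A P Q m = (r, i)"
  shows "r \<in> tangent_space A m" "i \<in> tangent_space A m"
    "T m (i - N m r) d =
      operator_rep A\<^sub>0 N\<^sub>0 d (snd d (\<tau> m), torsion_form A\<^sub>0 N\<^sub>0 d (\<tau> m) (T m (fst (P m)) d) (T m (fst (Q m)) d))"
proof -
  have c: "c \<in> charts_at A m" and d: "d \<in> charts_at A\<^sub>0 (\<tau> m)" and m: "m \<in> carrier A"
    using sm W by (auto simp: charts_at_iff manifold_open_def)
  let ?p = "snd c m" let ?\<phi> = "map_rep c d \<tau>"
  let ?D = "frechet_derivative ?\<phi> (at ?p)"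
  let ?J = "\<lambda>w. operator_rep A\<^sub>0 N\<^sub>0 d (snd d (\<tau> m), w)"
  let ?G = "\<lambda>v h. frechet_derivative (operator_rep A\<^sub>0 N\<^sub>0 d) (at (snd d (\<tau> m), v)) (h, 0)"
  have pS: "?p \<in> snd c ` V" using sm by auto
  have field: "differentiable_field_at A m X" if "vector_field_on A W X" for X
    by (rule M.vector_field_on_imp_differentiable_field_at[OF W that])
  have dP: "differentiable_field_at A m (\<lambda>q. fst (P q))" "differentiable_field_at A m (\<lambda>q. snd (P q))"
    and dQ: "differentiable_field_at A m (\<lambda>q. fst (Q q))" "differentiable_field_at A m (\<lambda>q. snd (Q q))"
    using P(1) Q(1) field by (auto simp: complex_vector_field_on_def)
  \<comment> \<open>\<open>x Z\<close> is the field \<open>T Z\<close> along \<open>\<tau>\<close> in coordinates, and \<open>x' Z\<close> its derivative at \<open>m\<close>.\<close>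
  define x where "x Z = (\<lambda>p. frechet_derivative ?\<phi> (at p) (local_rep Z c p))" for Z
  define x' where "x' Z = frechet_derivative (x Z) (at ?p)" for Z
  have xp: "x Z ?p = T m (Z m) d" if "Z m \<in> tangent_space A m" for Z
    using T_chart[OF c d that] by (simp add: x_def M.local_rep_chart[OF c])
  have x': "(x Z has_derivative x' Z) (at ?p)" if Z: "differentiable_field_at A m Z" for Z
    unfolding x'_def frechet_derivative_works[symmetric] unfolding x_def
    by (rule smooth_on_pushforward_differentiable[OF sm(7) pS differentiableI[OF M.local_rep_has_derivative[OF Z c]]])
  have br: "T m (lie_bracket A Y Z m) d = x' Y (Z m c) - x' Z (Y m c)"
    if Y: "differentiable_field_at A m Y" and Z: "differentiable_field_at A m Z" for Y Z
    using smooth_on_bracket[OF sm(7) pS M.local_rep_has_derivative[OF Y c] M.local_rep_has_derivative[OF Z c]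
        x'[OF Y, unfolded x_def] x'[OF Z, unfolded x_def]]
      T_chart[OF c d M.lie_bracket_tangent[OF m Y Z]]
    by (simp add: M.local_rep_chart[OF c] lie_bracket_def c)
  have y': "x' (\<lambda>q. snd (R q)) h = ?G (T m (fst (R m)) d) (?D h) + ?J (x' (\<lambda>q. fst (R q)) h)"
    if R: "differentiable_field_at A m (\<lambda>q. fst (R q))" "\<And>q. q \<in> W \<Longrightarrow> R q \<in> Zhat_plus A A\<^sub>0 \<tau> N q" for R h
  proof -
    let ?X = "\<lambda>q. fst (R q)" let ?Y = "\<lambda>q. snd (R q)"
    have "?\<phi> ?p = snd d (\<tau> m)" using c by (simp add: M.atlas.chart_inv_chart charts_at_iff)
    from M\<^sub>0.operator_rep_compose_has_derivative[OF N\<^sub>0 d rep_has_derivative[OF c d] this x'[OF R(1)]]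
    have "((\<lambda>p. operator_rep A\<^sub>0 N\<^sub>0 d (?\<phi> p, x ?X p)) has_derivative
        (\<lambda>h. ?G (x ?X ?p) (?D h) + ?J (x' ?X h))) (at ?p)" .
    moreover have "\<forall>\<^sub>F p in nhds ?p. operator_rep A\<^sub>0 N\<^sub>0 d (?\<phi> p, x ?X p) = x ?Y p"
      using M.atlas.eventually_chart_inv_in[OF c W] M.atlas.eventually_chart_inv_in[OF c sm(3,4)]
    proof eventually_elim
      case (elim p)
      define q where "q = chart_inv c p"
      have q: "p = snd c q" "c \<in> charts_at A q" "d \<in> charts_at A\<^sub>0 (\<tau> q)" "q \<in> W" "q \<in> carrier A"
        using elim c d sm(6) M.manifold_open_carrier[OF W(1)] by (auto simp: q_def charts_at_iff)
      have R': "fst (R q) \<in> tangent_space A q" "snd (R q) \<in> tangent_space A q"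
        "T q (snd (R q)) = N\<^sub>0 (\<tau> q) (T q (fst (R q)))"
        using R(2)[OF q(4)] Zhat_plus_iff[OF q(5), of "fst (R q)" "snd (R q)"] by auto
      have "x ?X p = T q (fst (R q)) d" "x ?Y p = T q (snd (R q)) d"
        using T_chart[OF q(2,3) R'(1)] T_chart[OF q(2,3) R'(2)]
        by (simp_all add: x_def local_rep_def q_def[symmetric] q(1)[symmetric])
      moreover have "?\<phi> p = snd d (\<tau> q)" by (simp add: q_def)
      ultimately show ?case
        using M\<^sub>0.operator_rep_chart[OF N\<^sub>0 q(3) T_in[OF q(5) R'(1)]] R'(3) by simp
    qed
    ultimately have "(x ?Y has_derivative (\<lambda>h. ?G (x ?X ?p) (?D h) + ?J (x' ?X h))) (at ?p)"
      by (rule has_derivative_eventually_eq)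
    from fun_cong[OF frechet_derivative_at[OF this], of h] show ?thesis
      using xp[of ?X] M.differentiable_field_at_tangent[OF R(1)] by (simp add: x'_def)
  qed
  let ?X = "\<lambda>q. fst (P q)" let ?Y = "\<lambda>q. snd (P q)" let ?X' = "\<lambda>q. fst (Q q)" let ?Y' = "\<lambda>q. snd (Q q)"
  have ri: "r = lie_bracket A ?X ?X' m - lie_bracket A ?Y ?Y' m" "i = lie_bracket A ?X ?Y' m + lie_bracket A ?Y ?X' m"
    using b by (simp_all add: complex_lie_bracket_def Let_def)
  note lb = M.lie_bracket_tangent[OF m dP(1) dQ(1)] M.lie_bracket_tangent[OF m dP(2) dQ(2)]
    M.lie_bracket_tangent[OF m dP(1) dQ(2)] M.lie_bracket_tangent[OF m dP(2) dQ(1)]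
  show r: "r \<in> tangent_space A m" and i: "i \<in> tangent_space A m"
    unfolding ri by (intro M.atlas.tangent_space_diff M.atlas.tangent_space_add lb)+
  interpret J: bounded_linear ?J by (rule M\<^sub>0.bounded_linear_operator_rep[OF N\<^sub>0 d])
  have NJ: "N\<^sub>0 (\<tau> m) v d = ?J (v d)" if "v \<in> tangent_space A\<^sub>0 (\<tau> m)" for v
    using M\<^sub>0.operator_rep_chart[OF N\<^sub>0 d that] by simp
  have m0: "\<tau> m \<in> carrier A\<^sub>0" using d by (rule charts_at_imp_carrier)
  have JJ: "?J (?J w) = - w" for w
  proof -
    let ?v = "tangent_of A\<^sub>0 d (\<tau> m) w"
    have v: "?v \<in> tangent_space A\<^sub>0 (\<tau> m)" by (rule M\<^sub>0.atlas.tangent_of_in[OF d])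
    have "?J (?J (?v d)) = N\<^sub>0 (\<tau> m) (N\<^sub>0 (\<tau> m) ?v) d"
      by (simp only: NJ[OF N_operator_tangent[OF N\<^sub>0 m0 v]] NJ[OF v])
    also have "\<dots> = - ?v d" by (simp add: J2[OF v])
    finally show ?thesis using d by simp
  qed
  have at_m: "T m (snd (R m)) d = ?J (T m (fst (R m)) d) \<and> ?D (fst (R m) c) = T m (fst (R m)) d \<and> ?D (snd (R m) c) = ?J (T m (fst (R m)) d)"
    if "R m \<in> Zhat_plus A A\<^sub>0 \<tau> N m" for R
  proof -
    have R: "fst (R m) \<in> tangent_space A m" "snd (R m) \<in> tangent_space A m"
        "T m (snd (R m)) = N\<^sub>0 (\<tau> m) (T m (fst (R m)))"
      using that Zhat_plus_iff[OF m, of "fst (R m)" "snd (R m)"] by auto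
    show ?thesis using R(3) NJ[OF T_in[OF m R(1)]] T_chart[OF c d R(1)] T_chart[OF c d R(2)] by simp
  qed
  note aP = at_m[of P, OF P(2)[OF W(2)]] and aQ = at_m[of Q, OF Q(2)[OF W(2)]]
  have "T m (i - N m r) d = T m i d - ?J (T m r d)"
    using T_diff[OF m i N_operator_tangent[OF N m r]] T_N[OF m r] NJ[OF T_in[OF m r]] by simp
  also have "\<dots> = ?J (torsion_form A\<^sub>0 N\<^sub>0 d (\<tau> m) (T m (fst (P m)) d) (T m (fst (Q m)) d))"
    unfolding ri torsion_form_def Let_def
    by (simp add: T_add[OF m lb(3,4)] T_diff[OF m lb(1,2)] br dP dQ y'[OF dP(1) P(2)] y'[OF dQ(1) Q(2)] aP aQ
        J.add J.diff JJ)
  finally show "T m (i - N m r) d = ?J (torsion_form A\<^sub>0 N\<^sub>0 d (\<tau> m) (T m (fst (P m)) d) (T m (fst (Q m)) d))" .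
qed

lemma involutive_if_complex_structure:
  assumes "complex_structure A\<^sub>0 N\<^sub>0"
  shows "involutive A (Zhat_plus A A\<^sub>0 \<tau> N)"
  unfolding involutive_def
proof (intro allI impI ballI)
  fix W P Q m
  assume W: "manifold_open A W" and P: "complex_vector_field_on A W P" and Q: "complex_vector_field_on A W Q"
    and PZ: "\<forall>m\<in>W. P m \<in> Zhat_plus A A\<^sub>0 \<tau> N m" and QZ: "\<forall>m\<in>W. Q m \<in> Zhat_plus A A\<^sub>0 \<tau> N m" and m: "m \<in> W"
  have mc: "m \<in> carrier A" using W m by (rule M.manifold_open_carrier)
  then have "\<tau> m \<in> carrier A\<^sub>0" using \<tau>_onto by blast
  then have J2: "\<And>v. v \<in> tangent_space A\<^sub>0 (\<tau> m) \<Longrightarrow> N\<^sub>0 (\<tau> m) (N\<^sub>0 (\<tau> m) v) = - v"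
    and ni: "nijenhuis_operator A\<^sub>0 N\<^sub>0"
    using assms unfolding complex_structure_def almost_complex_structure_def by blast+
  obtain c d V where sm: "c \<in> A" "d \<in> A\<^sub>0" "manifold_open A V" "m \<in> V" "V \<subseteq> fst c" "V \<subseteq> carrier A" "\<tau> ` V \<subseteq> fst d"
      "smooth_on (map_rep c d \<tau>) (snd c ` V)"
    using \<tau>_smooth mc by (rule smooth_map_onE)
  have d: "d \<in> charts_at A\<^sub>0 (\<tau> m)" using sm by (auto simp: charts_at_iff)
  obtain r i where ri: "complex_lie_bracket A P Q m = (r, i)" by (cases "complex_lie_bracket A P Q m")
  note D = complex_bracket_defect[OF sm(1-5,7,8) W m P _ Q _ J2 ri]
  have r: "r \<in> tangent_space A m" and i: "i \<in> tangent_space A m"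
    using D(1,2) PZ QZ by blast+
  have ir: "i - N m r \<in> tangent_space A m"
    by (intro M.atlas.tangent_space_diff i N_operator_tangent[OF N mc r])
  interpret J: bounded_linear "\<lambda>w. operator_rep A\<^sub>0 N\<^sub>0 d (snd d (\<tau> m), w)"
    by (rule M\<^sub>0.bounded_linear_operator_rep[OF N\<^sub>0 d])
  have "T m (i - N m r) d =
      operator_rep A\<^sub>0 N\<^sub>0 d (snd d (\<tau> m), torsion_form A\<^sub>0 N\<^sub>0 d (\<tau> m) (T m (fst (P m)) d) (T m (fst (Q m)) d))"
    using D(3) PZ QZ by blast
  then have "T m (i - N m r) d = (0 :: ('k, 'f) tvec) d"
    by (simp add: M\<^sub>0.nijenhuis_operator_imp_torsion_form[OF N\<^sub>0 ni d] J.zero)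
  with T_in[OF mc ir] M\<^sub>0.atlas.tangent_space_zero d have "T m (i - N m r) = 0" by (rule M\<^sub>0.atlas.tangent_eqI)
  then show "complex_lie_bracket A P Q m \<in> Zhat_plus A A\<^sub>0 \<tau> N m"
    unfolding ri using r i ir by (simp add: Zhat_plus_def vertical_def)
qed

lemma square_vertical_iff:
  "(\<forall>m\<in>carrier A. \<forall>v\<in>tangent_space A m. N m (N m v) + v \<in> vertical A A\<^sub>0 \<tau> m) \<longleftrightarrow>
    almost_complex_structure A\<^sub>0 N\<^sub>0"
proof -
  have *: "N m (N m v) + v \<in> vertical A A\<^sub>0 \<tau> m \<longleftrightarrow> N\<^sub>0 (\<tau> m) (N\<^sub>0 (\<tau> m) (T m v)) = - T m v"
    if m: "m \<in> carrier A" and v: "v \<in> tangent_space A m" for m v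
  proof -
    note Nv = N_operator_tangent[OF N m v]
    note NNv = N_operator_tangent[OF N m Nv]
    show ?thesis using M.atlas.tangent_space_add[OF NNv v]
      by (simp add: vertical_def T_add[OF m NNv v] T_N[OF m Nv] T_N[OF m v] eq_neg_iff_add_eq_0)
  qed
  have "(\<forall>m\<in>carrier A. \<forall>v\<in>tangent_space A m. N m (N m v) + v \<in> vertical A A\<^sub>0 \<tau> m) \<longleftrightarrow>
     (\<forall>m\<in>carrier A. \<forall>w\<in>T m ` tangent_space A m. N\<^sub>0 (\<tau> m) (N\<^sub>0 (\<tau> m) w) = - w)"
    using * by simp
  also have "\<dots> \<longleftrightarrow> (\<forall>m\<in>carrier A. \<forall>w\<in>tangent_space A\<^sub>0 (\<tau> m). N\<^sub>0 (\<tau> m) (N\<^sub>0 (\<tau> m) w) = - w)"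
    using T_onto by simp
  also have "\<dots> \<longleftrightarrow> (\<forall>m\<in>\<tau> ` carrier A. \<forall>w\<in>tangent_space A\<^sub>0 m. N\<^sub>0 m (N\<^sub>0 m w) = - w)"
    by blast
  finally show ?thesis using N\<^sub>0 by (simp add: \<tau>_onto almost_complex_structure_def)
qed

text \<open>
  Given two vectors of the tangent space at \<open>\<tau> m\<close>, their preimages under \<open>T\<close> extend to sections \<open>X + i NX\<close> of
  \<open>Z\<^sub>+\<close>; the two vectors determine the defect of the bracket at \<open>m\<close>, which is \<open>N\<^sub>0\<close> of their torsion.
  As \<open>N\<^sub>0\<^sup>2 = -id\<close>, applying \<open>N\<^sub>0\<close> once more recovers the torsion up to sign.
\<close>
lemma nijenhuis_if_involutive:
  assumes ac: "almost_complex_structure A\<^sub>0 N\<^sub>0" and inv: "involutive A (Zhat_plus A A\<^sub>0 \<tau> N)"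
  shows "nijenhuis_operator A\<^sub>0 N\<^sub>0"
proof (rule M\<^sub>0.nijenhuis_operatorI[OF N\<^sub>0])
  fix m\<^sub>0 assume "m\<^sub>0 \<in> carrier A\<^sub>0"
  then obtain m where m: "m \<in> carrier A" "m\<^sub>0 = \<tau> m" using \<tau>_onto by blast
  have m0: "\<tau> m \<in> carrier A\<^sub>0" using m(1) \<tau>_onto by blast
  then have J2: "\<And>v. v \<in> tangent_space A\<^sub>0 (\<tau> m) \<Longrightarrow> N\<^sub>0 (\<tau> m) (N\<^sub>0 (\<tau> m) v) = - v"
    using ac unfolding almost_complex_structure_def by blast
  obtain c d V where sm: "c \<in> A" "d \<in> A\<^sub>0" "manifold_open A V" "m \<in> V" "V \<subseteq> fst c" "V \<subseteq> carrier A" "\<tau> ` V \<subseteq> fst d"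
      "smooth_on (map_rep c d \<tau>) (snd c ` V)"
    using \<tau>_smooth m(1) by (rule smooth_map_onE)
  have d: "d \<in> charts_at A\<^sub>0 (\<tau> m)" using sm by (auto simp: charts_at_iff)
  let ?J = "\<lambda>w. operator_rep A\<^sub>0 N\<^sub>0 d (snd d (\<tau> m), w)"
  interpret J: bounded_linear ?J by (rule M\<^sub>0.bounded_linear_operator_rep[OF N\<^sub>0 d])
  have "torsion_form A\<^sub>0 N\<^sub>0 d (\<tau> m) v w = 0" for v w
  proof -
    have lift: "\<exists>W P. manifold_open A W \<and> m \<in> W \<and> complex_vector_field_on A W P \<and>
        (\<forall>q\<in>W. P q \<in> Zhat_plus A A\<^sub>0 \<tau> N q) \<and> T m (fst (P m)) d = e" for e
    proof -
      have "tangent_of A\<^sub>0 d (\<tau> m) e \<in> tangent_space A\<^sub>0 (\<tau> m)" by (rule M\<^sub>0.atlas.tangent_of_in[OF d])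
      then obtain u where u: "u \<in> tangent_space A m" "T m u = tangent_of A\<^sub>0 d (\<tau> m) e"
        using T_onto[OF m(1)] by (metis imageE)
      obtain W X where W: "manifold_open A W" "m \<in> W" "vector_field_on A W X"
        "vector_field_on A W (\<lambda>q. N q (X q))" "X m = u"
        using M.ex_vector_field_with_smooth_image[OF N m(1) u(1)] by blast
      have "(X q, N q (X q)) \<in> Zhat_plus A A\<^sub>0 \<tau> N q" if "q \<in> W" for q
      proof -
        have q: "q \<in> carrier A" using W(1) that by (rule M.manifold_open_carrier)
        have X: "X q \<in> tangent_space A q" using W(3) that by (auto simp: vector_field_on_def)
        show ?thesis using X N_operator_tangent[OF N q X] T_N[OF q X] by (simp add: Zhat_plus_iff[OF q])
      qed
      then show ?thesis using W u d
        by (intro exI[of _ W] exI[of _ "\<lambda>q. (X q, N q (X q))"]) (simp add: complex_vector_field_on_def)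
    qed
    obtain W1 P where 1: "manifold_open A W1" "m \<in> W1" "complex_vector_field_on A W1 P"
        "\<And>q. q\<in>W1 \<Longrightarrow> P q \<in> Zhat_plus A A\<^sub>0 \<tau> N q" "T m (fst (P m)) d = v" using lift[of v] by blast
    obtain W2 Q where 2: "manifold_open A W2" "m \<in> W2" "complex_vector_field_on A W2 Q"
        "\<And>q. q\<in>W2 \<Longrightarrow> Q q \<in> Zhat_plus A A\<^sub>0 \<tau> N q" "T m (fst (Q m)) d = w" using lift[of w] by blast
    let ?W = "W1 \<inter> W2"
    have W: "manifold_open A ?W" "m \<in> ?W" using 1 2 by (auto intro: M.atlas.manifold_open_Int)
    have P: "complex_vector_field_on A ?W P" and Q: "complex_vector_field_on A ?W Q"
      using 1(3) 2(3) W(1) unfolding complex_vector_field_on_def by (blast intro: M.vector_field_on_subset)+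
    have PZ: "P q \<in> Zhat_plus A A\<^sub>0 \<tau> N q" and QZ: "Q q \<in> Zhat_plus A A\<^sub>0 \<tau> N q" if "q \<in> ?W" for q
      using 1(4) 2(4) that by auto
    obtain r i where ri: "complex_lie_bracket A P Q m = (r, i)" by (cases "complex_lie_bracket A P Q m")
    have "(r, i) \<in> Zhat_plus A A\<^sub>0 \<tau> N m"
      using inv[unfolded involutive_def, rule_format, OF W(1) P Q _ _ W(2)] PZ QZ ri by simp
    then have "T m (i - N m r) = 0" by (simp add: Zhat_plus_def vertical_def)
    moreover note complex_bracket_defect(3)[OF sm(1-5,7,8) W P PZ Q QZ J2 ri]
    ultimately have J0: "?J (torsion_form A\<^sub>0 N\<^sub>0 d (\<tau> m) v w) = 0" using 1(5) 2(5) by simp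
    let ?u = "tangent_of A\<^sub>0 d (\<tau> m) (torsion_form A\<^sub>0 N\<^sub>0 d (\<tau> m) v w)"
    have u: "?u \<in> tangent_space A\<^sub>0 (\<tau> m)" by (rule M\<^sub>0.atlas.tangent_of_in[OF d])
    have Nu: "N\<^sub>0 (\<tau> m) ?u \<in> tangent_space A\<^sub>0 (\<tau> m)" by (rule N_operator_tangent[OF N\<^sub>0 m0 u])
    have "N\<^sub>0 (\<tau> m) ?u d = 0" using M\<^sub>0.operator_rep_chart[OF N\<^sub>0 d u] J0 d by simp
    then have "N\<^sub>0 (\<tau> m) (N\<^sub>0 (\<tau> m) ?u) d = 0"
      using M\<^sub>0.operator_rep_chart[OF N\<^sub>0 d Nu] J.zero by simp
    then show ?thesis using J2[OF u] d by simp
  qed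
  then show "\<exists>c\<in>charts_at A\<^sub>0 m\<^sub>0. \<forall>v w. torsion_form A\<^sub>0 N\<^sub>0 c m\<^sub>0 v w = 0"
    using d m(2) by blast
qed

end

theorem theorem4p2:
  fixes A :: "('m, 'e::banach) atlas"
    and A\<^sub>0 :: "('k, 'f::banach) atlas"
    and \<tau> :: "'m \<Rightarrow> 'k"
    and N :: "'m \<Rightarrow> ('m, 'e) tvec \<Rightarrow> ('m, 'e) tvec"
    and N\<^sub>0 :: "'k \<Rightarrow> ('k, 'f) tvec \<Rightarrow> ('k, 'f) tvec"
  assumes "banach_manifold A" and "banach_manifold A\<^sub>0"
    and "fibration A A\<^sub>0 \<tau>"
    and "N_operator A N" and "N_operator A\<^sub>0 N\<^sub>0"
    and "projects_to A A\<^sub>0 \<tau> N N\<^sub>0"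
  shows "(complex_structure A\<^sub>0 N\<^sub>0 \<longleftrightarrow>
            (\<forall>m\<in>carrier A. \<forall>v\<in>tangent_space A m. N m (N m v) + v \<in> vertical A A\<^sub>0 \<tau> m) \<and>
            involutive A (Zhat_plus A A\<^sub>0 \<tau> N)) \<and>
         (involutive A (Zhat_plus A A\<^sub>0 \<tau> N) \<longleftrightarrow> involutive A (Zhat_minus A A\<^sub>0 \<tau> N))"
proof -
  interpret projected_operator A A\<^sub>0 \<tau> N N\<^sub>0
    using assms by (intro projected_operator.intro projected_operator_axioms.intro)
  have "complex_structure A\<^sub>0 N\<^sub>0 \<longleftrightarrow> almost_complex_structure A\<^sub>0 N\<^sub>0 \<and> involutive A (Zhat_plus A A\<^sub>0 \<tau> N)"
    using involutive_if_complex_structure nijenhuis_if_involutive complex_structure_def by metis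
  moreover have "involutive A (Zhat_minus A A\<^sub>0 \<tau> N)" if "involutive A (Zhat_plus A A\<^sub>0 \<tau> N)"
    using that by (rule M.involutive_conjugate) (rule Zhat_minus_iff)
  moreover have "involutive A (Zhat_plus A A\<^sub>0 \<tau> N)" if "involutive A (Zhat_minus A A\<^sub>0 \<tau> N)"
    using that by (rule M.involutive_conjugate) (simp add: Zhat_minus_iff)
  ultimately show ?thesis unfolding square_vertical_iff by blast
qed

end
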